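(* For any partition $\lambda=(\lambda_1,\dots,\lambda_l)$ with conjugate partition $\lambda'=(\lambda_1',\dots,\lambda_k')$ one has, in $\Lambda$, $$Y_{-\lambda_1}\cdots Y_{-\lambda_l}.1=(-1)^{|\lambda|}\,Y_{\lambda_1'}^*\cdots Y_{\lambda_k'}^*.1,$$ $$W_{-\lambda_1}\cdots W_{-\lambda_l}.1=(-1)^{|\lambda|}\,W_{\lambda_1'}^*\cdots W_{\lambda_k'}^*.1.$$ Moreover, as $\lambda$ runs over all partitions, each of the two families $\{Y_{-\lambda_1}\cdots Y_{-\lambda_l}.1\}_\lambda$ and $\{W_{-\lambda_1}\cdots W_{-\lambda_l}.1\}_\lambda$ is a $\mathbb Z$-basis of the ring $\Lambda_{\mathbb Z}$ of symmetric functions with integer coefficients.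
   Context: $\Lambda=\Lambda_{\mathbb Q}=\mathbb Q[p_1,p_2,\dots]$ is the ring of symmetric functions over $\mathbb Q$ in countably many variables, where $p_n=\sum_i x_i^n$ are the power sums; $\Lambda_{\mathbb Z}\subset\Lambda$ is the subring of symmetric functions with integer coefficients. $|\lambda|=\sum_i\lambda_i$, and "$.1$" means applying an operator to $1\in\Lambda$. The following are vertex operators $\Lambda\to\Lambda[[z,z^{-1}]]$: $$Y(z)=\exp\Big(\sum_{n\ge1}\frac{p_n}{n}z^n\Big)\exp\Big(-\sum_{n\ge1}\frac{\partial}{\partial p_n}(z^{-n}+z^n)\Big)=\sum_{n\in\mathbb Z}Y_nz^{-n},$$ $$W^*(z)=\exp\Big(-\sum_{n\ge1}\frac{p_n}{n}z^n\Big)\exp\Big(\sum_{n\ge1}\frac{\partial}{\partial p_n}(z^{-n}+z^n)\Big)=\sum_{n\in\mathbb Z}W^*_nz^{n},$$ $$Y^*(z)=(1-z^2)W^*(z)=\sum_{n\in\mathbb Z}Y^*_nz^n,\qquad W(z)=(1-z^2)Y(z)=\sum_{n\in\mathbb Z}W_nz^{-n}.$$ Here $p_n$ acts by multiplication. On any given element of $\Lambda$ the exponential of derivatives gives a Laurent polynomial in $z$, so the coefficients $Y_n,Y^*_n,W_n,W_n^*$ are well-defined linear operators on $\Lambda$. *)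

theory Defs
  imports
    "HOL-Library.Poly_Mapping"
    "HOL-Computational_Algebra.Formal_Laurent_Series"
begin

section \<open>The ring of symmetric functions\<close>

text \<open>
  Elements of \<open>\<Lambda> = \<rat>[p\<^sub>1, p\<^sub>2, \<dots>]\<close> are polynomials, given as finitely supported
  maps from monomials to coefficients.  There is no variable \<open>p\<^sub>0\<close>: a monomial \<open>m\<close> stands for
  the product of all \<open>p\<^sub>i\<^sub>+\<^sub>1\<close> raised to the power \<open>lookup m i\<close>.
\<close>

type_synonym Lam = "(nat \<Rightarrow>\<^sub>0 nat) \<Rightarrow>\<^sub>0 rat"

definition Lam_const :: "rat \<Rightarrow> Lam"
  where "Lam_const c = Poly_Mapping.single 0 c"

text \<open>\<open>Lam_p n\<close> and \<open>Lam_deriv n\<close> are meant for \<open>n \<ge> 1\<close> only.\<close>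

definition Lam_p :: "nat \<Rightarrow> Lam"
  where "Lam_p n = Poly_Mapping.single (Poly_Mapping.single (n - 1) 1) 1"

definition Lam_deriv :: "nat \<Rightarrow> Lam \<Rightarrow> Lam"
  where "Lam_deriv n f =
    (\<Sum>m \<in> Poly_Mapping.keys f.
       Poly_Mapping.single (m - Poly_Mapping.single (n - 1) 1)
         (of_nat (Poly_Mapping.lookup m (n - 1)) * Poly_Mapping.lookup f m))"


subsection \<open>Formal power series in the variables \<open>x\<^sub>0, x\<^sub>1, \<dots>\<close>\<close>

text \<open>
  Arbitrary (possibly infinite) formal sums of monomials in countably many variables,
  with the convolution product.
\<close>

typedef 'a xseries = "UNIV :: ((nat \<Rightarrow>\<^sub>0 nat) \<Rightarrow> 'a) set"
  morphisms xcoeff Xseries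
  by simp

lemma xcoeff_Xseries [simp]: "xcoeff (Xseries F) = F"
  by (simp add: Xseries_inverse)

lemma xseries_eqI: "(\<And>m. xcoeff f m = xcoeff g m) \<Longrightarrow> f = g"
  using xcoeff_inject by blast

definition splits :: "(nat \<Rightarrow>\<^sub>0 nat) \<Rightarrow> ((nat \<Rightarrow>\<^sub>0 nat) \<times> (nat \<Rightarrow>\<^sub>0 nat)) set"
  where "splits m = {(a, b). a + b = m}"

lemma finite_splits: "finite (splits m)"
proof -
  let ?K = "Poly_Mapping.keys m"
  let ?B = "Max (Poly_Mapping.lookup m ` ?K)"
  let ?S = "{h. \<forall>x. (x \<in> ?K \<longrightarrow> h x \<in> {..?B}) \<and> (x \<notin> ?K \<longrightarrow> h x = (0::nat))}"
  have fin: "finite ?S"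
    by (rule finite_set_of_finite_funs) auto
  have "(Poly_Mapping.lookup \<circ> fst) ` splits m \<subseteq> ?S"
  proof (rule subsetI, elim imageE, intro CollectI allI, unfold o_def)
    fix h u x
    assume "h = Poly_Mapping.lookup (fst u)" "u \<in> splits m"
    moreover define a where "a = fst u"
    moreover define b where "b = snd u"
    ultimately have h: "h = Poly_Mapping.lookup a" and "(a, b) \<in> splits m" by auto
    then have m: "Poly_Mapping.lookup m x = Poly_Mapping.lookup a x + Poly_Mapping.lookup b x" for x
      by (auto simp: splits_def lookup_add)
    show "(x \<in> ?K \<longrightarrow> h x \<in> {..?B}) \<and> (x \<notin> ?K \<longrightarrow> h x = 0)"
      unfolding h
    proof (intro conjI impI)
      assume "x \<in> ?K"
      then have "Poly_Mapping.lookup m x \<le> ?B" by (intro Max_ge) auto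
      then show "Poly_Mapping.lookup a x \<in> {..?B}" using m[of x] by simp
    next
      assume "x \<notin> ?K"
      then show "Poly_Mapping.lookup a x = 0" using m[of x] by (simp add: in_keys_iff)
    qed
  qed
  then have "finite ((Poly_Mapping.lookup \<circ> fst) ` splits m)"
    using fin by (rule finite_subset)
  moreover have "inj_on (Poly_Mapping.lookup \<circ> fst) (splits m)"
    by (auto simp: inj_on_def splits_def lookup_inject)
  ultimately show ?thesis by (rule finite_imageD)
qed

instantiation xseries :: (comm_ring_1) comm_ring_1
begin

definition "0 = Xseries (\<lambda>m. 0)"
definition "1 = Xseries (\<lambda>m. if m = 0 then 1 else 0)"
definition "f + g = Xseries (\<lambda>m. xcoeff f m + xcoeff g m)"
definition "f - g = Xseries (\<lambda>m. xcoeff f m - xcoeff g m)"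
definition "- f = Xseries (\<lambda>m. - xcoeff f m)"
definition "f * g = Xseries (\<lambda>m. \<Sum>(a, b) \<in> splits m. xcoeff f a * xcoeff g b)"

instance
proof
  fix f g h :: "'a xseries"
  show "f + g + h = f + (g + h)" "f + g = g + f" "0 + f = f" "- f + f = 0" "f - g = f + - g"
    by (auto intro!: xseries_eqI
        simp: plus_xseries_def zero_xseries_def minus_xseries_def uminus_xseries_def)
  show "(0 :: 'a xseries) \<noteq> 1"
  proof
    assume "(0 :: 'a xseries) = 1"
    then have "xcoeff (0 :: 'a xseries) 0 = xcoeff 1 0" by simp
    then show False by (simp add: zero_xseries_def one_xseries_def)
  qed
  show "f * g = g * f"
  proof (rule xseries_eqI)
    fix m
    show "xcoeff (f * g) m = xcoeff (g * f) m"
      unfolding times_xseries_def xcoeff_Xseries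
      by (rule sum.reindex_bij_witness[of _ "\<lambda>(a, b). (b, a)" "\<lambda>(a, b). (b, a)"])
        (auto simp: splits_def add.commute mult.commute)
  qed
  show "(f + g) * h = f * h + g * h"
    by (rule xseries_eqI)
      (simp add: times_xseries_def plus_xseries_def distrib_right sum.distrib case_prod_unfold)
  show "1 * f = f"
  proof (rule xseries_eqI)
    fix m
    have "xcoeff (1 * f) m =
        (\<Sum>u \<in> splits m. (if fst u = 0 then 1 else 0) * xcoeff f (snd u))"
      by (simp add: times_xseries_def one_xseries_def case_prod_unfold)
    also have "\<dots> = (\<Sum>u \<in> {(0 :: nat \<Rightarrow>\<^sub>0 nat, m)}. (if fst u = 0 then 1 else 0) * xcoeff f (snd u))"
      by (rule sum.mono_neutral_right) (use finite_splits in \<open>auto simp: splits_def\<close>)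
    finally show "xcoeff (1 * f) m = xcoeff f m" by simp
  qed
  show "f * g * h = f * (g * h)"
  proof (rule xseries_eqI)
    fix m
    have "xcoeff (f * g * h) m =
        (\<Sum>u \<in> splits m. \<Sum>v \<in> splits (fst u).
           xcoeff f (fst v) * xcoeff g (snd v) * xcoeff h (snd u))"
      by (simp add: times_xseries_def case_prod_unfold sum_distrib_right)
    also have "\<dots> = (\<Sum>w \<in> (SIGMA u:splits m. splits (fst u)).
           xcoeff f (fst (snd w)) * xcoeff g (snd (snd w)) * xcoeff h (snd (fst w)))"
      by (subst sum.Sigma) (auto simp: finite_splits case_prod_unfold)
    also have "\<dots> = (\<Sum>w \<in> (SIGMA u:splits m. splits (snd u)).
           xcoeff f (fst (fst w)) * (xcoeff g (fst (snd w)) * xcoeff h (snd (snd w))))"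
      by (rule sum.reindex_bij_witness[of _
            "\<lambda>((a, d), (b, c)). ((a + b, c), (a, b))"
            "\<lambda>((d, c), (a, b)). ((a, b + c), (b, c))"])
        (auto simp: splits_def add.assoc mult.assoc)
    also have "\<dots> = (\<Sum>u \<in> splits m. \<Sum>v \<in> splits (snd u).
           xcoeff f (fst u) * (xcoeff g (fst v) * xcoeff h (snd v)))"
      by (subst sum.Sigma) (auto simp: finite_splits case_prod_unfold)
    also have "\<dots> = xcoeff (f * (g * h)) m"
      by (simp add: times_xseries_def case_prod_unfold sum_distrib_left)
    finally show "xcoeff (f * g * h) m = xcoeff (f * (g * h)) m" .
  qed
qed

end

definition xconst :: "'a :: comm_ring_1 \<Rightarrow> 'a xseries"
  where "xconst c = Xseries (\<lambda>m. if m = 0 then c else 0)"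

definition power_sum :: "nat \<Rightarrow> 'a :: comm_ring_1 xseries"
  where "power_sum n = Xseries (\<lambda>m. if \<exists>i. m = Poly_Mapping.single i n then 1 else 0)"

text \<open>
  The ring homomorphism \<open>p\<^sub>n \<mapsto> \<Sum>\<^sub>i x\<^sub>i\<^sup>n\<close> through which a polynomial in the \<open>p\<^sub>n\<close> is
  regarded as a symmetric function.
\<close>

definition expand :: "Lam \<Rightarrow> rat xseries"
  where "expand f =
    (\<Sum>m \<in> Poly_Mapping.keys f.
       xconst (Poly_Mapping.lookup f m) * (\<Prod>i \<in> Poly_Mapping.keys m. power_sum (i + 1) ^ Poly_Mapping.lookup m i))"

text \<open>
  Every element of \<open>\<Lambda>\<close> is a symmetric function with rational coefficients; \<open>\<Lambda>\<^sub>\<int>\<close> consists of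
  those whose coefficients, as a series in the \<open>x\<^sub>i\<close>, are integers.
\<close>

definition Lam_Z :: "Lam set"
  where "Lam_Z = {f. \<forall>m. xcoeff (expand f) m \<in> \<int>}"


section \<open>Vertex operators\<close>

text \<open>\<open>\<Sum>\<^sub>n\<^sub>\<ge>\<^sub>1 (p\<^sub>n / n) z\<^sup>n\<close>\<close>

definition p_series :: "Lam fps"
  where "p_series = Abs_fps (\<lambda>n. if n = 0 then 0 else Lam_const (1 / of_nat n) * Lam_p n)"

text \<open>The library's \<open>fps_exp\<close> needs coefficients in a field, which \<open>\<Lambda>\<close> is not.\<close>

definition exp_fps :: "Lam fps \<Rightarrow> Lam fps"
  where "exp_fps G = fps_compose (Abs_fps (\<lambda>k. Lam_const (1 / fact k))) G"

text \<open>
  \<open>\<partial>/\<partial>p\<^sub>n\<close> acts coefficientwise on series in \<open>z\<close>, and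
  \<open>zderiv F = \<Sum>\<^sub>n\<^sub>\<ge>\<^sub>1 (z\<^sup>-\<^sup>n + z\<^sup>n) \<partial>F/\<partial>p\<^sub>n\<close>.  The sum over \<open>n\<close> is only used for Laurent
  polynomials \<open>F\<close>, where it has finitely many nonzero terms.
\<close>

definition fls_deriv_p :: "nat \<Rightarrow> Lam fls \<Rightarrow> Lam fls"
  where "fls_deriv_p n F = Abs_fls (\<lambda>j. Lam_deriv n (fls_nth F j))"

definition zderiv :: "Lam fls \<Rightarrow> Lam fls"
  where "zderiv F =
    Sum_any (\<lambda>n. (fls_X_intpow (- int n) + fls_X_intpow (int n)) * fls_deriv_p n F when n \<ge> 1)"

text \<open>
  \<open>exp_zderiv c f\<close> is \<open>exp(c \<Sum>\<^sub>n\<^sub>\<ge>\<^sub>1 \<partial>/\<partial>p\<^sub>n (z\<^sup>-\<^sup>n + z\<^sup>n)) f\<close>, the exponential series being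
  finite on every \<open>f \<in> \<Lambda>\<close> (see \<open>finite_exp_zderiv\<close> below).
\<close>

definition exp_zderiv :: "rat \<Rightarrow> Lam \<Rightarrow> Lam fls"
  where "exp_zderiv c f =
    Sum_any (\<lambda>k. fls_const (Lam_const (c ^ k / fact k)) * (zderiv ^^ k) (fls_const f))"

lemma Lam_deriv_0 [simp]: "Lam_deriv n 0 = 0"
  by (simp add: Lam_deriv_def)

lemma fls_nth_fls_deriv_p: "fls_nth (fls_deriv_p n F) j = Lam_deriv n (fls_nth F j)"
proof -
  have "\<forall>i < fls_subdegree F. Lam_deriv n (fls_nth F i) = 0" by simp
  then show ?thesis
    unfolding fls_deriv_p_def by (rule nth_Abs_fls_lower_bound)
qed

text \<open>
  All monomials of all coefficients of \<open>F\<close> involve only variables indexed by \<open>V\<close> and have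
  (ungraded) degree at most \<open>d\<close>.  This serves to show that the sums over \<open>n\<close> and over \<open>k\<close>
  above are finite wherever they are used.
\<close>

definition degree_bound :: "nat set \<Rightarrow> nat \<Rightarrow> Lam fls \<Rightarrow> bool"
  where "degree_bound V d F \<longleftrightarrow>
    (\<forall>j. \<forall>m \<in> Poly_Mapping.keys (fls_nth F j).
       Poly_Mapping.keys m \<subseteq> V \<and> (\<Sum>i\<in>V. Poly_Mapping.lookup m i) \<le> d)"

lemma keys_Lam_deriv:
  assumes "m \<in> Poly_Mapping.keys (Lam_deriv n f)"
  obtains u where "u \<in> Poly_Mapping.keys f" "m = u - Poly_Mapping.single (n - 1) 1"
    "n - 1 \<in> Poly_Mapping.keys u"
proof -
  have "m \<in> (\<Union>u \<in> Poly_Mapping.keys f. Poly_Mapping.keys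
         (Poly_Mapping.single (u - Poly_Mapping.single (n - 1) 1)
            (of_nat (Poly_Mapping.lookup u (n - 1)) * Poly_Mapping.lookup f u)))"
    using assms unfolding Lam_deriv_def by (rule subsetD[OF Poly_Mapping.keys_sum])
  then obtain u where u: "u \<in> Poly_Mapping.keys f"
      "m \<in> Poly_Mapping.keys (Poly_Mapping.single (u - Poly_Mapping.single (n - 1) 1)
            (of_nat (Poly_Mapping.lookup u (n - 1)) * Poly_Mapping.lookup f u))"
    by blast
  from u(2) have "m = u - Poly_Mapping.single (n - 1) 1" "Poly_Mapping.lookup u (n - 1) \<noteq> 0"
    by (simp_all add: keys_single split: if_splits)
  with u(1) that show thesis by (simp add: in_keys_iff)
qed

lemma degree_bound_deriv:
  assumes "degree_bound V d F" "finite V"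
  shows "degree_bound V (d - 1) (fls_deriv_p n F)"
  unfolding degree_bound_def
proof (intro allI ballI)
  fix j m
  assume "m \<in> Poly_Mapping.keys (fls_nth (fls_deriv_p n F) j)"
  then obtain u where u: "u \<in> Poly_Mapping.keys (fls_nth F j)"
      "m = u - Poly_Mapping.single (n - 1) 1" "n - 1 \<in> Poly_Mapping.keys u"
    unfolding fls_nth_fls_deriv_p by (elim keys_Lam_deriv)
  then have V: "Poly_Mapping.keys u \<subseteq> V" "(\<Sum>i\<in>V. Poly_Mapping.lookup u i) \<le> d"
    using assms unfolding degree_bound_def by auto
  have m: "Poly_Mapping.lookup m i =
      Poly_Mapping.lookup u i - (if i = n - 1 then 1 else 0)" for i
    by (auto simp: u(2) lookup_minus lookup_single when_def)
  have "Poly_Mapping.keys m \<subseteq> V"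
    using V(1) by (auto simp: in_keys_iff m)
  moreover have "(\<Sum>i\<in>V. Poly_Mapping.lookup m i) < (\<Sum>i\<in>V. Poly_Mapping.lookup u i)"
  proof (rule sum_strict_mono_ex1[OF assms(2)])
    show "\<forall>i\<in>V. Poly_Mapping.lookup m i \<le> Poly_Mapping.lookup u i"
      by (simp add: m)
    have "Poly_Mapping.lookup m (n - 1) < Poly_Mapping.lookup u (n - 1)"
      using u(3) by (simp only: m in_keys_iff) simp
    then show "\<exists>i\<in>V. Poly_Mapping.lookup m i < Poly_Mapping.lookup u i"
      using u(3) V(1) by blast
  qed
  ultimately show "Poly_Mapping.keys m \<subseteq> V \<and> (\<Sum>i\<in>V. Poly_Mapping.lookup m i) \<le> d - 1"
    using V(2) by (intro conjI) (assumption, linarith)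
qed

lemma deriv_eq_0:
  assumes "degree_bound V d F" "n - 1 \<notin> V \<or> d = 0" "finite V"
  shows "fls_deriv_p n F = 0"
proof (rule fls_eqI)
  fix j
  have "u \<notin> Poly_Mapping.keys (fls_nth F j)" if "n - 1 \<in> Poly_Mapping.keys u" for u
  proof
    assume "u \<in> Poly_Mapping.keys (fls_nth F j)"
    with assms(1) have "Poly_Mapping.keys u \<subseteq> V" "(\<Sum>i\<in>V. Poly_Mapping.lookup u i) \<le> d"
      unfolding degree_bound_def by auto
    with that assms(2,3) have "n - 1 \<in> V" "\<forall>i\<in>V. Poly_Mapping.lookup u i = 0"
      by auto
    with that show False by (simp add: in_keys_iff)
  qed
  then have "Poly_Mapping.keys (fls_nth (fls_deriv_p n F) j) = {}"
    unfolding fls_nth_fls_deriv_p by (meson ex_in_conv keys_Lam_deriv)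
  then show "fls_nth (fls_deriv_p n F) j = fls_nth 0 j" by simp
qed

lemma degree_bound_add:
  assumes "degree_bound V d F" "degree_bound V d G"
  shows "degree_bound V d (F + G)"
  unfolding degree_bound_def
proof (intro allI ballI)
  fix j m
  assume "m \<in> Poly_Mapping.keys (fls_nth (F + G) j)"
  then have "m \<in> Poly_Mapping.keys (fls_nth F j) \<or> m \<in> Poly_Mapping.keys (fls_nth G j)"
    using Poly_Mapping.keys_add[of "fls_nth F j" "fls_nth G j"] by auto
  then show "Poly_Mapping.keys m \<subseteq> V \<and> (\<Sum>i\<in>V. Poly_Mapping.lookup m i) \<le> d"
    using assms unfolding degree_bound_def by blast
qed

lemma degree_bound_sum:
  assumes "finite A" "\<And>n. n \<in> A \<Longrightarrow> degree_bound V d (F n)"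
  shows "degree_bound V d (\<Sum>n\<in>A. F n)"
  using assms
proof (induction A rule: finite_induct)
  case empty
  then show ?case by (simp add: degree_bound_def)
next
  case (insert n A)
  have "degree_bound V d (F n + (\<Sum>n\<in>A. F n))"
    by (rule degree_bound_add) (use insert in simp_all)
  with insert show ?case by simp
qed

lemma degree_bound_shift: "degree_bound V d F \<Longrightarrow> degree_bound V d (fls_shift k F)"
  by (auto simp: degree_bound_def)

lemma finite_zderiv:
  assumes "degree_bound V d F" "finite V"
  shows "finite {n. ((fls_X_intpow (- int n) + fls_X_intpow (int n)) * fls_deriv_p n F
            when n \<ge> 1) \<noteq> 0}"
proof (rule finite_subset)
  show "finite (Suc ` V)" using assms(2) by simp
  show "{n. ((fls_X_intpow (- int n) + fls_X_intpow (int n)) * fls_deriv_p n F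
            when n \<ge> 1) \<noteq> 0} \<subseteq> Suc ` V"
  proof clarify
    fix n
    assume "((fls_X_intpow (- int n) + fls_X_intpow (int n)) * fls_deriv_p n F when n \<ge> 1) \<noteq> 0"
    then have "n \<ge> 1" "fls_deriv_p n F \<noteq> 0" by (auto simp: when_def split: if_splits)
    then show "n \<in> Suc ` V"
      using deriv_eq_0[OF assms(1) _ assms(2)] by (intro image_eqI[of _ _ "n - 1"]) auto
  qed
qed

lemma degree_bound_zderiv:
  assumes "degree_bound V d F" "finite V"
  shows "degree_bound V (d - 1) (zderiv F)"
proof -
  let ?T = "\<lambda>n. (fls_X_intpow (- int n) + fls_X_intpow (int n)) * fls_deriv_p n F when n \<ge> 1"
  have G: "degree_bound V (d - 1) (?T n)" for n
  proof (cases "n \<ge> 1")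
    case True
    have G: "degree_bound V (d - 1) (fls_deriv_p n F)"
      by (rule degree_bound_deriv[OF assms])
    have "?T n = fls_shift (- (- int n)) (fls_deriv_p n F) + fls_shift (- int n) (fls_deriv_p n F)"
      using True by (simp only: when_def if_True distrib_right fls_X_intpow_times_conv_shift(1))
    with degree_bound_add[OF degree_bound_shift[OF G] degree_bound_shift[OF G]]
    show ?thesis by (simp only:)
  next
    case False
    then show ?thesis by (simp add: degree_bound_def)
  qed
  have "zderiv F = sum ?T {n. ?T n \<noteq> 0}"
    unfolding zderiv_def by (rule Sum_any.expand_set)
  moreover have "degree_bound V (d - 1) (sum ?T {n. ?T n \<noteq> 0})"
    using finite_zderiv[OF assms] G by (rule degree_bound_sum)
  ultimately show ?thesis by (simp only:)
qed

lemma zderiv_eq_0: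
  assumes "degree_bound V 0 F" "finite V"
  shows "zderiv F = 0"
proof -
  have "fls_deriv_p n F = 0" for n
    by (rule deriv_eq_0[OF assms(1) disjI2[OF refl] assms(2)])
  then show ?thesis by (simp only: zderiv_def mult_zero_right when_def if_cancel Sum_any.neutral)
qed

lemma degree_bound_const:
  obtains V d where "finite V" "degree_bound V d (fls_const f)"
proof
  let ?V = "\<Union>m \<in> Poly_Mapping.keys f. Poly_Mapping.keys m"
  let ?deg = "\<lambda>m. \<Sum>i\<in>?V. Poly_Mapping.lookup m i"
  show "finite ?V" by simp
  show "degree_bound ?V (Max (?deg ` Poly_Mapping.keys f)) (fls_const f)"
    by (auto simp: degree_bound_def split: if_splits intro!: Max_ge)
qed

lemma finite_exp_zderiv: "finite {k. (zderiv ^^ k) (fls_const f) \<noteq> 0}"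
proof -
  obtain V d where V: "finite V" "degree_bound V d (fls_const f)"
    by (rule degree_bound_const)
  have b: "degree_bound V (d - k) ((zderiv ^^ k) (fls_const f))" for k
  proof (induction k)
    case (Suc k)
    from degree_bound_zderiv[OF Suc V(1)] show ?case by simp
  qed (use V in simp)
  have 0: "(zderiv ^^ Suc k) (fls_const f) = 0" if "k \<ge> d" for k
    using zderiv_eq_0[OF _ V(1)] b[of k] that by simp
  have "k \<le> d" if "(zderiv ^^ k) (fls_const f) \<noteq> 0" for k
  proof (rule ccontr)
    assume "\<not> k \<le> d"
    then show False using that 0[of "k - 1"] by (cases k) auto
  qed
  then have "{k. (zderiv ^^ k) (fls_const f) \<noteq> 0} \<subseteq> {..d}" by auto
  then show ?thesis using finite_subset by blast
qed

lemma finite_zderiv_iterate: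
  "finite {n. ((fls_X_intpow (- int n) + fls_X_intpow (int n))
             * fls_deriv_p n ((zderiv ^^ k) (fls_const f)) when n \<ge> 1) \<noteq> 0}"
proof -
  obtain V d where V: "finite V" "degree_bound V d (fls_const f)"
    by (rule degree_bound_const)
  have "\<exists>d. degree_bound V d ((zderiv ^^ k) (fls_const f))"
  proof (induction k)
    case (Suc k)
    then obtain d' where "degree_bound V d' ((zderiv ^^ k) (fls_const f))" ..
    from degree_bound_zderiv[OF this V(1)] show ?case by auto
  qed (use V(2) in auto)
  then obtain d' where "degree_bound V d' ((zderiv ^^ k) (fls_const f))" ..
  then show ?thesis using V(1) by (rule finite_zderiv)
qed

definition Y_series :: "Lam \<Rightarrow> Lam fls"
  where "Y_series f = fps_to_fls (exp_fps p_series) * exp_zderiv (- 1) f"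

definition Wstar_series :: "Lam \<Rightarrow> Lam fls"
  where "Wstar_series f = fps_to_fls (exp_fps (- p_series)) * exp_zderiv 1 f"

definition Ystar_series :: "Lam \<Rightarrow> Lam fls"
  where "Ystar_series f = (1 - fls_X ^ 2) * Wstar_series f"

definition W_series :: "Lam \<Rightarrow> Lam fls"
  where "W_series f = (1 - fls_X ^ 2) * Y_series f"

text \<open>Note the opposite signs: \<open>Y(z) = \<Sum> Y\<^sub>n z\<^sup>-\<^sup>n\<close> and likewise \<open>W\<close>, but
  \<open>Y\<^sup>*(z) = \<Sum> Y\<^sup>*\<^sub>n z\<^sup>n\<close> and likewise \<open>W\<^sup>*\<close>.\<close>

definition Y_op :: "int \<Rightarrow> Lam \<Rightarrow> Lam"
  where "Y_op n f = fls_nth (Y_series f) (- n)"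

definition W_op :: "int \<Rightarrow> Lam \<Rightarrow> Lam"
  where "W_op n f = fls_nth (W_series f) (- n)"

definition Ystar_op :: "int \<Rightarrow> Lam \<Rightarrow> Lam"
  where "Ystar_op n f = fls_nth (Ystar_series f) n"

definition Wstar_op :: "int \<Rightarrow> Lam \<Rightarrow> Lam"
  where "Wstar_op n f = fls_nth (Wstar_series f) n"

text \<open>\<open>op_word V [a\<^sub>1, \<dots>, a\<^sub>l]\<close> is \<open>V\<^bsub>a\<^sub>1\<^esub> \<cdots> V\<^bsub>a\<^sub>l\<^esub> . 1\<close>.\<close>

definition op_word :: "(int \<Rightarrow> Lam \<Rightarrow> Lam) \<Rightarrow> int list \<Rightarrow> Lam"
  where "op_word V as = foldr V as 1"


section \<open>Partitions and bases\<close>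

definition is_partition :: "nat list \<Rightarrow> bool"
  where "is_partition xs \<longleftrightarrow> sorted_wrt (\<ge>) xs \<and> (\<forall>x \<in> set xs. x > 0)"

definition conjugate :: "nat list \<Rightarrow> nat list"
  where "conjugate xs =
    (case xs of [] \<Rightarrow> []
     | a # _ \<Rightarrow> map (\<lambda>j. length (filter (\<lambda>x. j \<le> x) xs)) [1..<Suc a])"

abbreviation int_scale :: "int \<Rightarrow> Lam \<Rightarrow> Lam"
  where "int_scale k f \<equiv> of_int k * f"

lemma module_int_scale: "module int_scale"
  by unfold_locales (simp_all add: algebra_simps)

definition is_Z_basis :: "'i set \<Rightarrow> ('i \<Rightarrow> Lam) \<Rightarrow> Lam set \<Rightarrow> bool"
  where "is_Z_basis I b M \<longleftrightarrow>
    inj_on b I \<and> \<not> module.dependent int_scale (b ` I) \<and> module.span int_scale (b ` I) = M"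

end

theory Submission
  imports Defs
begin

text \<open>
  Write \<open>(A, B)\<close> for \<open>(Y, Y\<^sup>*)\<close> or \<open>(W, W\<^sup>*)\<close>.  The modes satisfy the charged fermion relations
  \<open>A\<^sub>i A\<^sub>j = - A\<^sub>j\<^sub>+\<^sub>1 A\<^sub>i\<^sub>-\<^sub>1\<close> and \<open>A\<^sub>i B\<^sub>j + B\<^sub>j\<^sub>+\<^sub>1 A\<^sub>i\<^sub>+\<^sub>1 = \<delta>\<^sub>i\<^sub>j\<close>.  Both sides of these have the same
  commutation rule with multiplication by \<open>p\<^sub>n\<close>, so it suffices to compare them on \<open>1\<close>.

  The mixed relation lets \<open>B\<^sub>l\<close> add a first column of height \<open>l\<close> to a word, up to the sign
  \<open>(-1)\<^sup>l\<close>, which gives the conjugation formula.  It also lets \<open>B\<^bsub>-m\<^esub>\<close>, for the largest \<open>\<lambda>\<^sub>1 = m\<close>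
  occurring in a linear combination, strip the first row from the words with \<open>\<lambda>\<^sub>1 = m\<close> and kill the
  others.  Iterating this isolates each coefficient; hence the words are independent, and, as \<open>B\<close>
  preserves \<open>\<Lambda>\<^sub>\<int>\<close>, a rational combination of words lying in \<open>\<Lambda>\<^sub>\<int>\<close> has integer coefficients.
  Finally the relation \<open>A\<^sub>i A\<^sub>j = - A\<^sub>j\<^sub>+\<^sub>1 A\<^sub>i\<^sub>-\<^sub>1\<close> straightens any word, so that the rational span
  of the partition words is closed under multiplication by each \<open>p\<^sub>n\<close> and hence is all of \<open>\<Lambda>\<close>.
\<close>


section \<open>The exponential of derivatives\<close>

lemma Lam_monomial_induct [case_names single add]:
  fixes f :: Lam
  assumes "\<And>u c. P (Poly_Mapping.single u c)" "\<And>f g. P f \<Longrightarrow> P g \<Longrightarrow> P (f + g)"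
  shows "P f"
proof (induction f rule: update_induct)
  case const
  show ?case using assms(1)[of 0 0] by simp
next
  case (update f a b)
  have "Poly_Mapping.update a b f = f + Poly_Mapping.single a b"
    using update(1)
    by (intro poly_mapping_eqI) (auto simp: lookup_update lookup_add lookup_single when_def in_keys_iff)
  then show ?case using assms update by metis
qed

lemma Lam_p_times_single:
  "Lam_p n * Poly_Mapping.single u c = Poly_Mapping.single (Poly_Mapping.single (n - 1) 1 + u) c"
  by (simp add: Lam_p_def mult_single)

text \<open>A monomial arises from a constant by multiplying with one power sum at a time. This is
  the form in which operator identities are checked below: each side has a simple commutation rule
  with \<open>Lam_p n\<close>.\<close>

lemma Lam_induct [case_names const add p]:
  assumes const: "\<And>c. P (Lam_const c)"
    and add: "\<And>f g. P f \<Longrightarrow> P g \<Longrightarrow> P (f + g)"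
    and p: "\<And>n f. n \<ge> 1 \<Longrightarrow> P f \<Longrightarrow> P (Lam_p n * f)"
  shows "P f"
proof (induction f rule: Lam_monomial_induct)
  case (single u c)
  show ?case
  proof (induction "\<Sum>i\<in>Poly_Mapping.keys u. Poly_Mapping.lookup u i" arbitrary: u rule: less_induct)
    case less
    show ?case
    proof (cases "u = 0")
      case True
      then show ?thesis using const by (simp add: Lam_const_def)
    next
      case False
      then obtain i where i: "i \<in> Poly_Mapping.keys u" by fastforce
      define v where "v = u - Poly_Mapping.single i 1"
      have lv: "Poly_Mapping.lookup v j = Poly_Mapping.lookup u j - (if j = i then 1 else 0)" for j
        by (auto simp: v_def lookup_minus lookup_single when_def)
      have u: "u = Poly_Mapping.single i 1 + v"
        using i by (intro poly_mapping_eqI) (auto simp: lv lookup_add lookup_single when_def in_keys_iff)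
      have "Poly_Mapping.keys v \<subseteq> Poly_Mapping.keys u" by (auto simp: lv in_keys_iff)
      then have "(\<Sum>j\<in>Poly_Mapping.keys v. Poly_Mapping.lookup v j)
          = (\<Sum>j\<in>Poly_Mapping.keys u. Poly_Mapping.lookup v j)"
        by (intro sum.mono_neutral_left) (auto simp: in_keys_iff)
      also have "\<dots> < (\<Sum>j\<in>Poly_Mapping.keys u. Poly_Mapping.lookup u j)"
        using i by (intro sum_strict_mono_ex1) (auto simp: lv in_keys_iff)
      finally have "P (Poly_Mapping.single v c)" by (rule less)
      from p[OF _ this, of "Suc i"] show ?thesis
        by (simp add: Lam_p_times_single u[symmetric, simplified])
    qed
  qed
next
  case (add f g)
  then show ?case by (rule assms(2))
qed

text \<open>Only the monomial \<open>m\<close> times the differentiated variable contributes.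
  Truncated subtraction may also send a monomial without that variable to \<open>m\<close>, but then
  the exponent in front is 0.\<close>

lemma lookup_Lam_deriv:
  "Poly_Mapping.lookup (Lam_deriv n f) m =
    of_nat (Poly_Mapping.lookup m (n - 1) + 1) * Poly_Mapping.lookup f (m + Poly_Mapping.single (n - 1) 1)"
proof -
  let ?e = "Poly_Mapping.single (n - 1) (1::nat)"
  have "Poly_Mapping.lookup (Lam_deriv n f) m =
     (\<Sum>u\<in>Poly_Mapping.keys f. (of_nat (Poly_Mapping.lookup u (n - 1)) * Poly_Mapping.lookup f u when u - ?e = m))"
    by (simp add: Lam_deriv_def lookup_sum lookup_single)
  also have "\<dots> = (\<Sum>u\<in>Poly_Mapping.keys f. if u = m + ?e then of_nat (Poly_Mapping.lookup m (n - 1) + 1) * Poly_Mapping.lookup f u else 0)"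
  proof (rule sum.cong[OF refl])
    fix u assume "u \<in> Poly_Mapping.keys f"
    show "(of_nat (Poly_Mapping.lookup u (n - 1)) * Poly_Mapping.lookup f u when u - ?e = m) =
      (if u = m + ?e then of_nat (Poly_Mapping.lookup m (n - 1) + 1) * Poly_Mapping.lookup f u else 0)"
    proof (cases "Poly_Mapping.lookup u (n - 1) = 0")
      case True
      then have "u \<noteq> m + ?e" by (auto simp: lookup_add)
      with True show ?thesis by simp
    next
      case False
      then have "u - ?e + ?e = u"
        by (intro poly_mapping_eqI) (auto simp: lookup_add lookup_minus lookup_single when_def)
      then have "u - ?e = m \<longleftrightarrow> u = m + ?e" by auto
      then show ?thesis by (auto simp: lookup_add)
    qed
  qed
  also have "\<dots> = of_nat (Poly_Mapping.lookup m (n - 1) + 1) * Poly_Mapping.lookup f (m + ?e)"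
    by (auto simp: sum.delta in_keys_iff)
  finally show ?thesis .
qed

lemma Lam_deriv_add: "Lam_deriv n (f + g) = Lam_deriv n f + Lam_deriv n g"
  by (rule poly_mapping_eqI) (simp add: lookup_Lam_deriv lookup_add algebra_simps)

lemma Lam_deriv_single:
  "Lam_deriv n (Poly_Mapping.single u c) =
    Poly_Mapping.single (u - Poly_Mapping.single (n - 1) 1) (of_nat (Poly_Mapping.lookup u (n - 1)) * c)"
  by (simp add: Lam_deriv_def)

text \<open>This is the Leibniz rule. The hypotheses keep the indices 0 and 1 apart, which
  \<open>n - 1\<close> identifies.\<close>

lemma Lam_deriv_p_times:
  assumes "n \<ge> 1" "k \<ge> 1"
  shows "Lam_deriv n (Lam_p k * f) = Lam_p k * Lam_deriv n f + (if n = k then f else 0)"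
proof (induction f rule: Lam_monomial_induct)
  case (single u c)
  let ?e = "\<lambda>k. Poly_Mapping.single (k - 1) (1::nat)"
  show ?case
  proof (cases "Poly_Mapping.lookup u (n - 1) = 0")
    case True
    then show ?thesis using assms
      by (auto simp: Lam_p_times_single Lam_deriv_single lookup_add lookup_single)
  next
    case False
    then have "?e k + u - ?e n = ?e k + (u - ?e n)"
      by (intro poly_mapping_eqI) (auto simp: lookup_add lookup_minus lookup_single when_def)
    moreover have "?e n + (u - ?e n) = u" using False
      by (intro poly_mapping_eqI) (auto simp: lookup_add lookup_minus lookup_single when_def)
    ultimately show ?thesis using assms
      by (auto simp: Lam_p_times_single Lam_deriv_single lookup_add lookup_single algebra_simps
          simp flip: single_add)
  qed
next
  case (add f g)
  then show ?case by (auto simp: distrib_left Lam_deriv_add)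
qed

section \<open>The derivation \<open>zderiv\<close> and its iterates\<close>

definition zeta :: "nat \<Rightarrow> Lam fls"
  where "zeta n = fls_X_intpow (- int n) + fls_X_intpow (int n)"

lemma fls_nth_X_intpow_times: "fls_nth (fls_X_intpow i * F) j = fls_nth (F :: Lam fls) (j - i)"
  by (simp add: fls_X_intpow_times_conv_shift)

lemma fls_nth_zeta_times:
  "fls_nth (zeta n * F) j = fls_nth F (j + int n) + fls_nth F (j - int n)"
  unfolding zeta_def distrib_right fls_plus_nth fls_nth_X_intpow_times by simp

lemma fls_deriv_p_add: "fls_deriv_p n (F + G) = fls_deriv_p n F + fls_deriv_p n G"
  by (rule fls_eqI) (simp add: fls_nth_fls_deriv_p Lam_deriv_add)

lemma fls_deriv_p_zeta: "fls_deriv_p n (zeta k * F) = zeta k * fls_deriv_p n F"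
  by (rule fls_eqI) (simp add: fls_nth_fls_deriv_p fls_nth_zeta_times Lam_deriv_add)

lemma fls_nth_const_times: "fls_nth (fls_const c * F) j = c * fls_nth (F :: Lam fls) j"
  by simp

lemma fls_deriv_p_p_times:
  assumes "n \<ge> 1" "k \<ge> 1"
  shows "fls_deriv_p n (fls_const (Lam_p k) * F) =
    fls_const (Lam_p k) * fls_deriv_p n F + (if n = k then F else 0)"
  using assms by (intro fls_eqI) (simp add: fls_nth_fls_deriv_p Lam_deriv_p_times)

text \<open>\<open>Sum_any\<close> returns 0 on an infinite support, so \<open>zderiv\<close> is
  well behaved only where almost all derivatives vanish. This condition turns it into an ordinary
  finite sum.\<close>

definition finite_derivs :: "Lam fls \<Rightarrow> bool"
  where "finite_derivs F \<longleftrightarrow> (\<exists>N. \<forall>n>N. fls_deriv_p n F = 0)"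

lemma zderiv_eq_sum:
  assumes "\<forall>n>N. fls_deriv_p n F = 0"
  shows "zderiv F = (\<Sum>n=1..N. zeta n * fls_deriv_p n F)"
proof -
  have "zderiv F = (\<Sum>n\<in>{1..N}. zeta n * fls_deriv_p n F when n \<ge> 1)"
    unfolding zderiv_def zeta_def[symmetric]
  proof (rule Sum_any.expand_superset)
    show "{n. (zeta n * fls_deriv_p n F when n \<ge> 1) \<noteq> 0} \<subseteq> {1..N}"
    proof
      fix n assume "n \<in> {n. (zeta n * fls_deriv_p n F when n \<ge> 1) \<noteq> 0}"
      then have "n \<ge> 1" "fls_deriv_p n F \<noteq> 0" by (auto simp: when_def split: if_splits)
      with assms show "n \<in> {1..N}" by (meson atLeastAtMost_iff not_le)
    qed
  qed simp
  then show ?thesis by (simp add: when_def)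
qed

lemma finite_derivs_add: "finite_derivs F \<Longrightarrow> finite_derivs G \<Longrightarrow> finite_derivs (F + G)"
  unfolding finite_derivs_def
proof (elim exE)
  fix N M assume "\<forall>n>N. fls_deriv_p n F = 0" "\<forall>n>M. fls_deriv_p n G = 0"
  then show "\<exists>N. \<forall>n>N. fls_deriv_p n (F + G) = 0"
    by (intro exI[of _ "max N M"]) (simp add: fls_deriv_p_add)
qed

lemma finite_derivs_zeta: "finite_derivs F \<Longrightarrow> finite_derivs (zeta k * F)"
  unfolding finite_derivs_def fls_deriv_p_zeta by (metis mult_zero_right)

lemma finite_derivs_p: "finite_derivs F \<Longrightarrow> k \<ge> 1 \<Longrightarrow> finite_derivs (fls_const (Lam_p k) * F)"
  unfolding finite_derivs_def
proof (elim exE)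
  fix N assume "\<forall>n>N. fls_deriv_p n F = 0" "k \<ge> 1"
  then show "\<exists>N. \<forall>n>N. fls_deriv_p n (fls_const (Lam_p k) * F) = 0"
    by (intro exI[of _ "max N k"]) (simp add: fls_deriv_p_p_times)
qed

lemma finite_derivs_of_nat: "finite_derivs F \<Longrightarrow> finite_derivs (of_nat j * F)"
proof (induction j)
  case 0
  have "fls_deriv_p n 0 = 0" for n by (rule fls_eqI) (simp add: fls_nth_fls_deriv_p)
  then show ?case by (simp add: finite_derivs_def)
qed (simp add: distrib_right finite_derivs_add)

lemma zderiv_add:
  assumes "finite_derivs F" "finite_derivs G"
  shows "zderiv (F + G) = zderiv F + zderiv G"
proof -
  obtain N M where NM: "\<forall>n>N. fls_deriv_p n F = 0" "\<forall>n>M. fls_deriv_p n G = 0"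
    using assms unfolding finite_derivs_def by auto
  then have *: "\<forall>n>max N M. fls_deriv_p n F = 0" "\<forall>n>max N M. fls_deriv_p n G = 0" by auto
  then have "\<forall>n>max N M. fls_deriv_p n (F + G) = 0" by (simp add: fls_deriv_p_add)
  with * show ?thesis
    by (simp only: zderiv_eq_sum fls_deriv_p_add distrib_left sum.distrib)
qed

lemma zderiv_zeta:
  assumes "finite_derivs F"
  shows "zderiv (zeta k * F) = zeta k * zderiv F"
proof -
  obtain N where *: "\<forall>n>N. fls_deriv_p n F = 0"
    using assms unfolding finite_derivs_def by auto
  then have "\<forall>n>N. fls_deriv_p n (zeta k * F) = 0" by (simp only: fls_deriv_p_zeta) simp
  with * show ?thesis
    by (simp only: zderiv_eq_sum fls_deriv_p_zeta sum_distrib_left mult.left_commute)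
qed

text \<open>\<open>zderiv\<close> is a derivation whose value on \<open>Lam_p k\<close> is
  \<open>zeta k\<close>, as only the derivative with index \<open>k\<close> sees this
  factor.\<close>

lemma zderiv_p:
  assumes "finite_derivs F" "k \<ge> 1"
  shows "zderiv (fls_const (Lam_p k) * F) = fls_const (Lam_p k) * zderiv F + zeta k * F"
proof -
  obtain N where *: "\<forall>n>N. fls_deriv_p n F = 0"
    using assms unfolding finite_derivs_def by auto
  \<comment> \<open>The range of summation has to include \<open>n = k\<close>, where the extra
    Leibniz term sits.\<close>
  define M where "M = max N k"
  have 1: "\<forall>n>M. fls_deriv_p n F = 0" using * by (simp add: M_def)
  have 2: "\<forall>n>M. fls_deriv_p n (fls_const (Lam_p k) * F) = 0"
    using * assms(2) by (simp add: fls_deriv_p_p_times M_def)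
  have "zderiv (fls_const (Lam_p k) * F) =
     (\<Sum>n=1..M. fls_const (Lam_p k) * (zeta n * fls_deriv_p n F) + (if n = k then zeta k * F else 0))"
    unfolding zderiv_eq_sum[OF 2]
  proof (rule sum.cong[OF refl])
    fix n assume "n \<in> {1..M}"
    then have "fls_deriv_p n (fls_const (Lam_p k) * F) =
        fls_const (Lam_p k) * fls_deriv_p n F + (if n = k then F else 0)"
      using assms(2) by (intro fls_deriv_p_p_times) auto
    then show "zeta n * fls_deriv_p n (fls_const (Lam_p k) * F) =
        fls_const (Lam_p k) * (zeta n * fls_deriv_p n F) + (if n = k then zeta k * F else 0)"
      by (simp only: distrib_left mult.left_commute) simp
  qed
  also have "\<dots> = fls_const (Lam_p k) * zderiv F + zeta k * F"
    unfolding zderiv_eq_sum[OF 1] sum.distrib sum_distrib_left[symmetric]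
    using assms(2) by (simp add: M_def)
  finally show ?thesis .
qed

lemma zderiv_of_nat:
  assumes "finite_derivs F"
  shows "zderiv (of_nat j * F) = of_nat j * zderiv F"
proof (induction j)
  case 0
  have "zderiv 0 = 0" by (rule zderiv_eq_0[of "{}"]) (auto simp: degree_bound_def)
  then show ?case by simp
next
  case (Suc j)
  then show ?case
    by (simp only: of_nat_Suc distrib_right mult_1 zderiv_add[OF assms finite_derivs_of_nat[OF assms]])
qed

lemma finite_derivs_iterate: "finite_derivs ((zderiv ^^ k) (fls_const f))"
proof -
  obtain V d where V: "finite V" "degree_bound V d (fls_const f)"
    by (rule degree_bound_const)
  have "\<exists>d. degree_bound V d ((zderiv ^^ k) (fls_const f))"
  proof (induction k)
    case (Suc k)
    then obtain d' where "degree_bound V d' ((zderiv ^^ k) (fls_const f))" ..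
    from degree_bound_zderiv[OF this V(1)] show ?case by auto
  qed (use V(2) in auto)
  then obtain d' where d': "degree_bound V d' ((zderiv ^^ k) (fls_const f))" ..
  have "fls_deriv_p n ((zderiv ^^ k) (fls_const f)) = 0" if "n > Suc (Max (insert 0 V))" for n
  proof (rule deriv_eq_0[OF d' _ V(1)])
    have "n - 1 \<notin> V" using that V(1)
      by (metis Max_ge Suc_lessE diff_Suc_1 finite.insertI insert_iff not_less)
    then show "n - 1 \<notin> V \<or> d' = 0" ..
  qed
  then show ?thesis unfolding finite_derivs_def by blast
qed

lemma zderiv_iterate_add:
  "(zderiv ^^ k) (fls_const (f + g)) = (zderiv ^^ k) (fls_const f) + (zderiv ^^ k) (fls_const g)"
  by (induction k) (simp_all add: zderiv_add finite_derivs_iterate fls_plus_const)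

text \<open>In the higher Leibniz rule only two terms survive, because \<open>zderiv\<close> sends
  \<open>Lam_p k\<close> to \<open>zeta k\<close>, which contains no power sum. For
  \<open>j = 0\<close> the value of \<open>j - 1\<close> is irrelevant: the factor
  \<open>of_nat j\<close> vanishes.\<close>

lemma zderiv_iterate_p:
  assumes "k \<ge> 1"
  shows "(zderiv ^^ j) (fls_const (Lam_p k * f)) =
    fls_const (Lam_p k) * (zderiv ^^ j) (fls_const f) +
    of_nat j * (zeta k * (zderiv ^^ (j - 1)) (fls_const f))"
proof (induction j)
  case (Suc j)
  let ?D = "\<lambda>j. (zderiv ^^ j) (fls_const f)"
  have "(zderiv ^^ Suc j) (fls_const (Lam_p k * f)) =
      zderiv (fls_const (Lam_p k) * ?D j + of_nat j * (zeta k * ?D (j - 1)))"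
    using Suc by simp
  also have "\<dots> = zderiv (fls_const (Lam_p k) * ?D j) + zderiv (of_nat j * (zeta k * ?D (j - 1)))"
    by (intro zderiv_add finite_derivs_p finite_derivs_of_nat finite_derivs_zeta
         finite_derivs_iterate assms)
  also have "zderiv (fls_const (Lam_p k) * ?D j) = fls_const (Lam_p k) * ?D (Suc j) + zeta k * ?D j"
    using assms by (simp add: zderiv_p finite_derivs_iterate)
  also have "zderiv (of_nat j * (zeta k * ?D (j - 1))) = of_nat j * (zeta k * zderiv (?D (j - 1)))"
    by (simp only: zderiv_of_nat finite_derivs_zeta finite_derivs_iterate zderiv_zeta)
  also have "\<dots> = of_nat j * (zeta k * ?D j)"
    by (cases j) simp_all
  finally show ?case by (simp add: algebra_simps)
qed simp

section \<open>The exponential of \<open>zderiv\<close> as a ring homomorphism\<close>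

lemma Lam_const_add: "Lam_const (a + b) = Lam_const a + Lam_const b"
  and Lam_const_mult: "Lam_const (a * b) = Lam_const a * Lam_const b"
  and Lam_const_0 [simp]: "Lam_const 0 = 0"
  and Lam_const_1 [simp]: "Lam_const 1 = 1"
  and Lam_const_minus: "Lam_const (- a) = - Lam_const a"
  and Lam_const_of_nat: "Lam_const (of_nat n) = of_nat n"
  by (simp_all add: Lam_const_def single_add mult_single single_uminus)

lemma exp_zderiv_eq_sum:
  assumes "\<forall>k>N. (zderiv ^^ k) (fls_const f) = 0"
  shows "exp_zderiv c f = (\<Sum>k\<le>N. fls_const (Lam_const (c ^ k / fact k)) * (zderiv ^^ k) (fls_const f))"
  unfolding exp_zderiv_def
proof (rule Sum_any.expand_superset)
  show "{k. fls_const (Lam_const (c ^ k / fact k)) * (zderiv ^^ k) (fls_const f) \<noteq> 0} \<subseteq> {..N}"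
    using assms by (auto simp: not_le dest!: mult_not_zero intro: ccontr)
qed simp

lemma zderiv_iterate_eventually_0: "\<exists>N. \<forall>k>N. (zderiv ^^ k) (fls_const f) = 0"
  using finite_exp_zderiv[of f] unfolding finite_nat_set_iff_bounded
  by (metis (mono_tags, lifting) mem_Collect_eq not_less_iff_gr_or_eq)

lemma exp_zderiv_add: "exp_zderiv c (f + g) = exp_zderiv c f + exp_zderiv c g"
proof -
  obtain N M where "\<forall>k>N. (zderiv ^^ k) (fls_const f) = 0" "\<forall>k>M. (zderiv ^^ k) (fls_const g) = 0"
    using zderiv_iterate_eventually_0 by meson
  then have *: "\<forall>k>max N M. (zderiv ^^ k) (fls_const f) = 0" "\<forall>k>max N M. (zderiv ^^ k) (fls_const g) = 0"
    by auto
  then have "\<forall>k>max N M. (zderiv ^^ k) (fls_const (f + g)) = 0"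
    by (simp add: zderiv_iterate_add)
  with * show ?thesis
    by (simp only: exp_zderiv_eq_sum zderiv_iterate_add distrib_left sum.distrib)
qed

lemma exp_zderiv_const: "exp_zderiv c (Lam_const q) = fls_const (Lam_const q)"
proof -
  have "zderiv (fls_const (Lam_const q)) = 0"
    by (rule zderiv_eq_0[of "{}"]) (auto simp: degree_bound_def Lam_const_def split: if_splits)
  moreover have "zderiv 0 = 0" by (rule zderiv_eq_0[of "{}"]) (auto simp: degree_bound_def)
  ultimately have "(zderiv ^^ k) (fls_const (Lam_const q)) = 0" if "k > 0" for k
    using that
  proof (induction k)
    case (Suc k)
    then show ?case by (cases k) simp_all
  qed simp
  then show ?thesis by (simp add: exp_zderiv_eq_sum[of 0])
qed

text \<open>In the exponential series the second term of \<open>zderiv_iterate_p\<close> carries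
  k/k! = 1/(k-1)!; after an index shift it is \<open>c * zeta n\<close> times the same
  series.\<close>

lemma exp_zderiv_p:
  assumes "n \<ge> 1"
  shows "exp_zderiv c (Lam_p n * f) = (fls_const (Lam_p n) + fls_const (Lam_const c) * zeta n) * exp_zderiv c f"
proof -
  obtain N where N: "\<forall>k>N. (zderiv ^^ k) (fls_const f) = 0"
    using zderiv_iterate_eventually_0 by meson
  let ?D = "\<lambda>j. (zderiv ^^ j) (fls_const f)"
  let ?a = "\<lambda>k. fls_const (Lam_const (c ^ k / fact k))"
  have a: "?a (Suc k) * of_nat (Suc k) = fls_const (Lam_const c) * ?a k" for k
  proof -
    have "c ^ Suc k / fact (Suc k) * of_nat (Suc k) = c * (c ^ k / fact k)"
      by (simp add: field_simps del: of_nat_Suc)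
    then have "Lam_const (c ^ Suc k / fact (Suc k)) * of_nat (Suc k) = Lam_const c * Lam_const (c ^ k / fact k)"
      by (metis Lam_const_mult Lam_const_of_nat)
    then show ?thesis by (metis fls_const_mult_const fls_of_nat)
  qed
  have "\<forall>k>Suc N. (zderiv ^^ k) (fls_const (Lam_p n * f)) = 0"
    using N by (simp add: zderiv_iterate_p[OF assms])
  then have "exp_zderiv c (Lam_p n * f) =
     (\<Sum>k\<le>Suc N. ?a k * (fls_const (Lam_p n) * ?D k + of_nat k * (zeta n * ?D (k - 1))))"
    by (simp only: exp_zderiv_eq_sum zderiv_iterate_p[OF assms])
  also have "\<dots> = fls_const (Lam_p n) * (\<Sum>k\<le>Suc N. ?a k * ?D k) +
      (\<Sum>k\<le>Suc N. ?a k * of_nat k * (zeta n * ?D (k - 1)))"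
    unfolding sum_distrib_left sum.distrib[symmetric]
    by (rule sum.cong) (simp_all add: algebra_simps)
  also have "(\<Sum>k\<le>Suc N. ?a k * ?D k) = exp_zderiv c f"
    using N by (subst exp_zderiv_eq_sum[of "Suc N"]) auto
  also have "(\<Sum>k\<le>Suc N. ?a k * of_nat k * (zeta n * ?D (k - 1))) =
      (\<Sum>k\<le>N. ?a (Suc k) * of_nat (Suc k) * (zeta n * ?D k))"
    by (subst sum.atMost_Suc_shift) simp
  also have "\<dots> = fls_const (Lam_const c) * zeta n * (\<Sum>k\<le>N. ?a k * ?D k)"
    unfolding a sum_distrib_left by (rule sum.cong) (simp_all only: mult_ac)
  also have "(\<Sum>k\<le>N. ?a k * ?D k) = exp_zderiv c f"
    using N by (subst exp_zderiv_eq_sum[of N]) auto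
  finally show ?thesis by (simp only: distrib_right mult.assoc)
qed

text \<open>By \<open>exp_zderiv_p\<close> the operator is the substitution of p_n +
  \<open>c * zeta n\<close> for every p_n, hence multiplicative.\<close>

lemma exp_zderiv_mult: "exp_zderiv c (f * g) = exp_zderiv c f * exp_zderiv c g"
proof (induction f rule: Lam_induct)
  case (const q)
  show ?case
  proof (induction g rule: Lam_induct)
    case (const r)
    show ?case by (simp add: exp_zderiv_const flip: Lam_const_mult)
  next
    case (add f g)
    then show ?case by (simp add: exp_zderiv_add distrib_left)
  next
    case (p n f)
    have "Lam_const q * (Lam_p n * f) = Lam_p n * (Lam_const q * f)" by (simp add: mult_ac)
    then show ?case
      by (simp only: exp_zderiv_p[OF p(1)] p(2)) (simp only: mult_ac)
  qed
next
  case (add f h)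
  then show ?case by (simp add: exp_zderiv_add distrib_right)
next
  case (p n f)
  then show ?case by (simp add: exp_zderiv_p mult.assoc)
qed


section \<open>Relations between the modes\<close>

text \<open>The equation expresses n times the n-th coefficient through lower ones, and n can be
  cancelled. Product formulas for generating series thus reduce to comparing logarithmic
  derivatives.\<close>

lemma fps_ode_unique:
  fixes F G P :: "'a :: {idom, semiring_char_0} fps"
  assumes F: "fps_deriv F = P * F" and G: "fps_deriv G = P * G" and 0: "fps_nth F 0 = fps_nth G 0"
  shows "F = G"
proof -
  have "fps_nth F n = fps_nth G n" for n
  proof (induction n rule: less_induct)
    case (less n)
    show ?case
    proof (cases n)
      case (Suc k)
      have "fps_nth (P * F) k = fps_nth (P * G) k"
        unfolding fps_mult_nth by (rule sum.cong) (use less Suc in auto)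
      then have "of_nat (Suc k) * fps_nth F (Suc k) = of_nat (Suc k) * fps_nth G (Suc k)"
        unfolding F[symmetric] G[symmetric] by simp
      then show ?thesis unfolding Suc mult_cancel_left of_nat_eq_0_iff by simp
    qed (use 0 in simp)
  qed
  then show ?thesis by (rule fps_ext)
qed

definition fps_map :: "('a \<Rightarrow> 'b) \<Rightarrow> 'a fps \<Rightarrow> 'b fps"
  where "fps_map \<phi> F = Abs_fps (\<lambda>n. \<phi> (fps_nth F n))"

lemma fps_nth_fps_map [simp]: "fps_nth (fps_map \<phi> F) n = \<phi> (fps_nth F n)"
  by (simp add: fps_map_def)

text \<open>Instances are \<open>fls_const\<close> and all \<open>exp_zderiv c\<close>. Applied
  coefficientwise to a series in an outer variable, they respect products and the derivative in that
  variable.\<close>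

locale unital_ring_hom =
  fixes \<phi> :: "'a :: comm_ring_1 \<Rightarrow> 'b :: comm_ring_1"
  assumes hom_add: "\<phi> (x + y) = \<phi> x + \<phi> y"
    and hom_mult: "\<phi> (x * y) = \<phi> x * \<phi> y"
    and hom_one: "\<phi> 1 = 1"
begin

lemma hom_zero: "\<phi> 0 = 0"
  using hom_add[of 0 0] by simp

lemma hom_of_nat: "\<phi> (of_nat n) = of_nat n"
  by (induction n) (simp_all add: hom_zero hom_one hom_add)

lemma hom_sum: "\<phi> (sum f S) = (\<Sum>x\<in>S. \<phi> (f x))"
  by (induction S rule: infinite_finite_induct) (simp_all add: hom_zero hom_add)

lemma fps_map_mult: "fps_map \<phi> (F * G) = fps_map \<phi> F * fps_map \<phi> G"
  by (rule fps_ext) (simp add: fps_mult_nth hom_sum hom_mult)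

lemma fps_map_deriv: "fps_map \<phi> (fps_deriv F) = fps_deriv (fps_map \<phi> F)"
  by (rule fps_ext) (simp add: hom_mult hom_add hom_of_nat hom_one)

lemma fps_map_one: "fps_map \<phi> 1 = 1"
  by (rule fps_ext) (simp add: hom_one hom_zero)

end

interpretation fls_const: unital_ring_hom "fls_const :: Lam \<Rightarrow> Lam fls"
  by unfold_locales (simp_all add: fls_plus_const)

interpretation exp_zderiv: unital_ring_hom "exp_zderiv c"
  using exp_zderiv_const[of c 1] by unfold_locales (simp_all add: exp_zderiv_add exp_zderiv_mult)

section \<open>Generating series of the complete and elementary symmetric functions\<close>

definition Hser :: "Lam fps" where "Hser = exp_fps p_series"
definition Eser :: "Lam fps" where "Eser = exp_fps (- p_series)"
text \<open>This is the logarithmic derivative of \<open>Hser\<close>, and the negative of that of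
  \<open>Eser\<close>.\<close>

definition Pser :: "Lam fps" where "Pser = Abs_fps (\<lambda>k. Lam_p (Suc k))"

lemma fps_deriv_exp_fps:
  assumes "fps_nth G 0 = 0"
  shows "fps_deriv (exp_fps G) = exp_fps G * fps_deriv G"
proof -
  have "fps_deriv (Abs_fps (\<lambda>k. Lam_const (1 / fact k))) = Abs_fps (\<lambda>k. Lam_const (1 / fact k))"
  proof (rule fps_ext)
    fix k
    have "of_nat (Suc k) * Lam_const (1 / fact (Suc k)) = Lam_const (of_nat (Suc k) * (1 / fact (Suc k)))"
      by (simp only: Lam_const_mult Lam_const_of_nat)
    then show "fps_nth (fps_deriv (Abs_fps (\<lambda>k. Lam_const (1 / fact k)))) k
        = fps_nth (Abs_fps (\<lambda>k. Lam_const (1 / fact k))) k"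
      by (simp add: field_simps del: of_nat_Suc)
  qed
  with assms show ?thesis unfolding exp_fps_def by (simp add: fps_compose_deriv)
qed

lemma fps_deriv_p_series: "fps_deriv p_series = Pser"
proof (rule fps_ext)
  fix k
  have "of_nat (Suc k) * Lam_const (1 / of_nat (Suc k)) = Lam_const (of_nat (Suc k) * (1 / of_nat (Suc k)))"
    by (simp only: Lam_const_mult Lam_const_of_nat)
  also have "\<dots> = 1" by (simp del: of_nat_Suc)
  finally show "fps_nth (fps_deriv p_series) k = fps_nth Pser k"
    by (simp add: p_series_def Pser_def mult.assoc[symmetric] del: of_nat_Suc)
qed

lemma fps_deriv_Hser: "fps_deriv Hser = Pser * Hser"
  unfolding Hser_def
  by (subst fps_deriv_exp_fps) (simp add: p_series_def, simp add: fps_deriv_p_series mult.commute)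

lemma fps_deriv_Eser: "fps_deriv Eser = - Pser * Eser"
  unfolding Eser_def
  by (subst fps_deriv_exp_fps) (simp add: p_series_def, simp add: fps_deriv_p_series mult.commute)

lemma Hser_0: "fps_nth Hser 0 = 1" and Eser_0: "fps_nth Eser 0 = 1"
  by (simp_all add: Hser_def Eser_def exp_fps_def)

lemma Hser_Eser: "Hser * Eser = 1"
  by (rule fps_ode_unique[where P = 0])
    (simp_all add: fps_deriv_Hser fps_deriv_Eser Hser_0 Eser_0)

text \<open>In the variable \<open>w\<close> of the outer series, \<open>Aser = (1 - z w) (1 - w/z)\<close>.\<close>

definition Aser :: "Lam fls fps"
  where "Aser = 1 - fps_const (zeta 1) * fps_X + fps_X ^ 2"

definition Zser :: "Lam fls fps" where "Zser = Abs_fps (\<lambda>k. zeta (Suc k))"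

text \<open>The \<open>zeta k\<close> are the power sums of z and 1/z, whose product is 1, so they
  obey this recurrence. It makes all but the first two coefficients of \<open>Aser * Zser\<close>
  vanish.\<close>

lemma zeta_times: "zeta 1 * zeta (Suc k) = zeta (Suc (Suc k)) + zeta k"
  by (simp only: zeta_def distrib_left distrib_right fls_X_intpow_times_fls_X_intpow)
    (simp add: algebra_simps)

lemma zeta_0: "zeta 0 = 2"
  by (simp add: zeta_def)

lemma fps_nth_Aser_times:
  "fps_nth (Aser * F) n = fps_nth F n - (if n \<ge> 1 then zeta 1 * fps_nth F (n - 1) else 0)
     + (if n \<ge> 2 then fps_nth F (n - 2) else 0)"
proof -
  have "Aser * F = F - fps_const (zeta 1) * (fps_X * F) + fps_X ^ 2 * F"
    by (simp add: Aser_def algebra_simps)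
  then show ?thesis by (auto simp: fps_X_power_mult_nth)
qed

text \<open>A factor 1 - x w has logarithmic derivative minus the sum of all x^(k+1) w^k; adding x =
  z and x = 1/z gives \<open>- Zser\<close>.\<close>

lemma fps_deriv_Aser: "fps_deriv Aser = - Zser * Aser"
proof (rule fps_ext)
  fix n
  have "fps_nth (- Zser * Aser) n = - fps_nth (Aser * Zser) n" by (simp add: mult.commute)
  also have "\<dots> = (if n = 0 then - zeta 1 else if n = 1 then 2 else 0)"
  proof -
    consider "n = 0" | "n = 1" | k where "n = Suc (Suc k)" by (cases n; cases "n - 1") auto
    then show ?thesis
    proof cases
      case 2
      then show ?thesis using zeta_times[of 0]
        by (simp add: fps_nth_Aser_times Zser_def zeta_0 del: fps_mult_nth_1')
    next
      case (3 k)
      then show ?thesis using zeta_times[of "Suc k"]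
        by (simp add: fps_nth_Aser_times Zser_def)
    qed (simp add: fps_nth_Aser_times Zser_def del: fps_mult_nth_0)
  qed
  also have "\<dots> = fps_nth (fps_deriv Aser) n"
    by (auto simp: Aser_def fps_X_power_nth)
  finally show "fps_nth (fps_deriv Aser) n = fps_nth (- Zser * Aser) n" ..
qed

lemma fps_map_exp_zderiv_Pser:
  "fps_map (exp_zderiv c) Pser = fps_map fls_const Pser + fps_const (fls_const (Lam_const c)) * Zser"
proof (rule fps_ext)
  fix k
  show "fps_nth (fps_map (exp_zderiv c) Pser) k =
      fps_nth (fps_map fls_const Pser + fps_const (fls_const (Lam_const c)) * Zser) k"
    using exp_zderiv_p[of "Suc k" c 1] exp_zderiv.hom_one[of c] by (simp add: Pser_def Zser_def)
qed

lemma fps_const_minus_1: "fps_const (fls_const (Lam_const (- 1))) = - 1"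
  by (simp add: Lam_const_minus flip: fps_const_neg)

text \<open>The substitution changes the logarithmic derivative \<open>Pser\<close> into
  \<open>Pser - Zser\<close>, which is also that of the right-hand side.\<close>

lemma exp_zderiv_Hser: "fps_map (exp_zderiv (- 1)) Hser = Aser * fps_map fls_const Hser"
proof (rule fps_ode_unique)
  show "fps_deriv (fps_map (exp_zderiv (- 1)) Hser) =
     (fps_map fls_const Pser - Zser) * fps_map (exp_zderiv (- 1)) Hser"
    by (simp add: fps_deriv_Hser exp_zderiv.fps_map_mult fps_map_exp_zderiv_Pser fps_const_minus_1
        flip: exp_zderiv.fps_map_deriv)
  show "fps_deriv (Aser * fps_map fls_const Hser) =
     (fps_map fls_const Pser - Zser) * (Aser * fps_map fls_const Hser)"
    by (simp add: fps_deriv_Hser fps_deriv_Aser fls_const.fps_map_mult algebra_simps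
        flip: fls_const.fps_map_deriv)
  show "fps_nth (fps_map (exp_zderiv (- 1)) Hser) 0 = fps_nth (Aser * fps_map fls_const Hser) 0"
    by (simp add: Hser_0 Aser_def exp_zderiv.hom_one)
qed

text \<open>With the opposite sign \<open>Hser\<close> is divided by \<open>Aser\<close>; the factor
  is kept on the left to avoid inverses.\<close>

lemma exp_zderiv_1_Hser: "Aser * fps_map (exp_zderiv 1) Hser = fps_map fls_const Hser"
proof (rule fps_ode_unique)
  have "fps_deriv (fps_map (exp_zderiv 1) Hser) =
     (fps_map fls_const Pser + Zser) * fps_map (exp_zderiv 1) Hser"
    by (simp add: fps_deriv_Hser exp_zderiv.fps_map_mult fps_map_exp_zderiv_Pser
        flip: exp_zderiv.fps_map_deriv)
  then show "fps_deriv (Aser * fps_map (exp_zderiv 1) Hser) =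
     fps_map fls_const Pser * (Aser * fps_map (exp_zderiv 1) Hser)"
    by (simp add: fps_deriv_Aser algebra_simps)
  show "fps_deriv (fps_map fls_const Hser) = fps_map fls_const Pser * fps_map fls_const Hser"
    by (simp add: fps_deriv_Hser fls_const.fps_map_mult flip: fls_const.fps_map_deriv)
  show "fps_nth (Aser * fps_map (exp_zderiv 1) Hser) 0 = fps_nth (fps_map fls_const Hser) 0"
    by (simp add: Hser_0 Aser_def exp_zderiv.hom_one)
qed

lemma exp_zderiv_Eser: "Aser * fps_map (exp_zderiv (- 1)) Eser = fps_map fls_const Eser"
proof -
  have "fps_map (exp_zderiv (- 1)) Hser * fps_map (exp_zderiv (- 1)) Eser = 1"
    by (simp add: Hser_Eser exp_zderiv.fps_map_one flip: exp_zderiv.fps_map_mult)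
  moreover have "fps_map fls_const Hser * fps_map fls_const Eser = (1 :: Lam fls fps)"
    by (simp add: Hser_Eser fls_const.fps_map_one flip: fls_const.fps_map_mult)
  moreover have "(Aser * fps_map (exp_zderiv (- 1)) Eser) * (fps_map fls_const Hser * fps_map fls_const Eser)
      = (Aser * fps_map fls_const Hser * fps_map (exp_zderiv (- 1)) Eser) * fps_map fls_const Eser"
    by (simp only: mult_ac)
  ultimately show ?thesis by (simp only: exp_zderiv_Hser mult_1_left mult_1_right)
qed

text \<open>\<open>hh n\<close> is the complete symmetric function \<open>h\<^sub>n\<close>, but \<open>ee n\<close> is the signed elementary one,
  \<open>(-1)\<^sup>n e\<^sub>n\<close>.\<close>

definition hh :: "int \<Rightarrow> Lam" where "hh = fls_nth (fps_to_fls Hser)"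
definition ee :: "int \<Rightarrow> Lam" where "ee = fls_nth (fps_to_fls Eser)"

lemma hh_neg [simp]: "n < 0 \<Longrightarrow> hh n = 0" and ee_neg [simp]: "n < 0 \<Longrightarrow> ee n = 0"
  and hh_0 [simp]: "hh 0 = 1" and ee_0 [simp]: "ee 0 = 1"
  and hh_of_nat: "hh (int k) = fps_nth Hser k" and ee_of_nat: "ee (int k) = fps_nth Eser k"
  by (simp_all add: hh_def ee_def Hser_0 Eser_0)

lemma hh_diff: "hh (int k - int j) = (if j \<le> k then fps_nth Hser (k - j) else 0)"
  and ee_diff: "ee (int k - int j) = (if j \<le> k then fps_nth Eser (k - j) else 0)"
  by (auto simp flip: of_nat_diff simp: hh_of_nat ee_of_nat)

lemma exp_zderiv_0 [simp]: "exp_zderiv c 0 = 0"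
  by (rule exp_zderiv.hom_zero)

text \<open>Coefficient comparison in \<open>exp_zderiv_Hser\<close>; since \<open>hh\<close>
  vanishes at negative indices, the formula holds for every integer.\<close>

lemma exp_zderiv_hh:
  "exp_zderiv (- 1) (hh n) =
    fls_const (hh n) - zeta 1 * fls_const (hh (n - 1)) + fls_const (hh (n - 2))"
proof (cases "n < 0")
  case False
  then obtain k where n: "n = int k" by (metis nat_int_comparison(1) nat_eq_iff2 not_less)
  have "exp_zderiv (- 1) (hh n) = fps_nth (fps_map (exp_zderiv (- 1)) Hser) k"
    by (simp add: n hh_of_nat)
  then show ?thesis
    unfolding exp_zderiv_Hser fps_nth_Aser_times
    by (auto simp: n hh_of_nat hh_diff[of k 1, simplified] hh_diff[of k 2, simplified])
qed simp

lemma exp_zderiv_1_hh: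
  "exp_zderiv 1 (hh n) - zeta 1 * exp_zderiv 1 (hh (n - 1)) + exp_zderiv 1 (hh (n - 2)) =
    fls_const (hh n)"
proof (cases "n < 0")
  case False
  then obtain k where n: "n = int k" by (metis nat_int_comparison(1) nat_eq_iff2 not_less)
  have "fls_const (hh n) = fps_nth (fps_map fls_const Hser) k"
    by (simp add: n hh_of_nat)
  then show ?thesis
    unfolding exp_zderiv_1_Hser[symmetric] fps_nth_Aser_times
    by (auto simp: n hh_of_nat hh_diff[of k 1, simplified] hh_diff[of k 2, simplified])
qed simp

lemma exp_zderiv_ee:
  "exp_zderiv (- 1) (ee n) - zeta 1 * exp_zderiv (- 1) (ee (n - 1)) + exp_zderiv (- 1) (ee (n - 2)) =
    fls_const (ee n)"
proof (cases "n < 0")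
  case False
  then obtain k where n: "n = int k" by (metis nat_int_comparison(1) nat_eq_iff2 not_less)
  have "fls_const (ee n) = fps_nth (fps_map fls_const Eser) k"
    by (simp add: n ee_of_nat)
  then show ?thesis
    unfolding exp_zderiv_Eser[symmetric] fps_nth_Aser_times
    by (auto simp: n ee_of_nat ee_diff[of k 1, simplified] ee_diff[of k 2, simplified])
qed simp

lemma sum_hh_ee: "(\<Sum>m\<le>s. hh (int m) * ee (int s - int m)) = (if s = 0 then 1 else 0)"
proof -
  have "(\<Sum>m\<le>s. hh (int m) * ee (int s - int m)) = fps_nth (Hser * Eser) s"
    unfolding fps_mult_nth atLeast0AtMost
    by (rule sum.cong) (simp_all add: hh_of_nat ee_diff)
  then show ?thesis by (simp add: Hser_Eser)
qed

section \<open>Linearity of the modes, their commutation with power sums, and their values on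
  \<open>hh\<close> and \<open>ee\<close>\<close>

lemma Y_series_alt: "Y_series f = fps_to_fls Hser * exp_zderiv (- 1) f"
  and Wstar_series_alt: "Wstar_series f = fps_to_fls Eser * exp_zderiv 1 f"
  by (simp_all add: Y_series_def Wstar_series_def Hser_def Eser_def)

lemma Y_op_add: "Y_op i (f + g) = Y_op i f + Y_op i g"
  and Wstar_op_add: "Wstar_op i (f + g) = Wstar_op i f + Wstar_op i g"
  by (simp_all add: Y_op_def Wstar_op_def Y_series_alt Wstar_series_alt exp_zderiv_add distrib_left)

lemma Y_op_const: "Y_op i (Lam_const c * f) = Lam_const c * Y_op i f"
  and Wstar_op_const: "Wstar_op i (Lam_const c * f) = Lam_const c * Wstar_op i f"
  by (simp_all add: Y_op_def Wstar_op_def Y_series_alt Wstar_series_alt exp_zderiv_mult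
      exp_zderiv_const mult.left_commute[of _ "fls_const _"])

text \<open>Moving \<open>Lam_p n\<close> out of the exponential costs \<open>- zeta n\<close>, and
  multiplying a series by \<open>zeta n\<close> shifts its modes by n in both directions.\<close>

lemma Y_op_p:
  assumes "n \<ge> 1"
  shows "Y_op i (Lam_p n * f) = Lam_p n * Y_op i f - Y_op (i - int n) f - Y_op (i + int n) f"
proof -
  have "Y_series (Lam_p n * f) = fls_const (Lam_p n) * Y_series f - zeta n * Y_series f"
    unfolding Y_series_alt exp_zderiv_p[OF assms] by (simp add: Lam_const_minus algebra_simps)
  then show ?thesis
    by (simp only: Y_op_def fls_minus_nth fls_nth_const_times fls_nth_zeta_times) (simp add: algebra_simps)
qed

lemma Wstar_op_p:
  assumes "n \<ge> 1"
  shows "Wstar_op i (Lam_p n * f) = Lam_p n * Wstar_op i f + Wstar_op (i - int n) f + Wstar_op (i + int n) f"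
proof -
  have "Wstar_series (Lam_p n * f) = fls_const (Lam_p n) * Wstar_series f + zeta n * Wstar_series f"
    unfolding Wstar_series_alt exp_zderiv_p[OF assms] by (simp add: algebra_simps)
  then show ?thesis
    by (simp only: Wstar_op_def fls_plus_nth fls_nth_const_times fls_nth_zeta_times) (simp add: algebra_simps)
qed

lemma Y_op_1: "Y_op i 1 = hh (- i)" and Wstar_op_1: "Wstar_op i 1 = ee i"
  by (simp_all add: Y_op_def Wstar_op_def Y_series_alt Wstar_series_alt exp_zderiv.hom_one hh_def ee_def)

lemma Y_op_0 [simp]: "Y_op i 0 = 0" and Wstar_op_0 [simp]: "Wstar_op i 0 = 0"
  using Y_op_const[of i 0 0] Wstar_op_const[of i 0 0] by simp_all

lemma Y_op_hh:
  "Y_op (- m) (hh n) = hh m * hh n - (hh (m + 1) + hh (m - 1)) * hh (n - 1) + hh m * hh (n - 2)"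
proof -
  have "Y_series (hh n) = fls_const (hh n) * fps_to_fls Hser
      - fls_const (hh (n - 1)) * (zeta 1 * fps_to_fls Hser) + fls_const (hh (n - 2)) * fps_to_fls Hser"
    by (simp add: Y_series_alt exp_zderiv_hh algebra_simps)
  then show ?thesis
    unfolding Y_op_def
    by (simp only: fls_plus_nth fls_minus_nth fls_nth_const_times fls_nth_zeta_times flip: hh_def)
      (simp add: algebra_simps)
qed

text \<open>In \<open>exp_zderiv_Eser\<close> the factor \<open>Aser\<close> stands on the side of
  the unknown, which yields a recurrence instead of a closed formula.\<close>

lemma Y_op_ee:
  "Y_op (- m) (ee n) - Y_op (- (m + 1)) (ee (n - 1)) - Y_op (- (m - 1)) (ee (n - 1)) + Y_op (- m) (ee (n - 2))
    = hh m * ee n"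
proof -
  have "Y_series (ee n) - zeta 1 * Y_series (ee (n - 1)) + Y_series (ee (n - 2))
      = fls_const (ee n) * fps_to_fls Hser"
    unfolding Y_series_alt exp_zderiv_ee[symmetric] by (simp add: algebra_simps)
  then have "fls_nth (Y_series (ee n) - zeta 1 * Y_series (ee (n - 1)) + Y_series (ee (n - 2))) m
      = fls_nth (fls_const (ee n) * fps_to_fls Hser) m" by (simp only:)
  then show ?thesis
    by (simp only: fls_plus_nth fls_minus_nth fls_nth_const_times fls_nth_zeta_times flip: hh_def)
      (simp add: Y_op_def algebra_simps)
qed

lemma Wstar_op_hh:
  "Wstar_op n (hh m) - Wstar_op (n + 1) (hh (m - 1)) - Wstar_op (n - 1) (hh (m - 1)) + Wstar_op n (hh (m - 2))
    = hh m * ee n"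
proof -
  have "Wstar_series (hh m) - zeta 1 * Wstar_series (hh (m - 1)) + Wstar_series (hh (m - 2))
      = fls_const (hh m) * fps_to_fls Eser"
    unfolding Wstar_series_alt exp_zderiv_1_hh[symmetric] by (simp add: algebra_simps)
  then have "fls_nth (Wstar_series (hh m) - zeta 1 * Wstar_series (hh (m - 1)) + Wstar_series (hh (m - 2))) n
      = fls_nth (fls_const (hh m) * fps_to_fls Eser) n" by (simp only:)
  then show ?thesis
    by (simp only: fls_plus_nth fls_minus_nth fls_nth_const_times fls_nth_zeta_times flip: ee_def)
      (simp add: Wstar_op_def algebra_simps)
qed

section \<open>The relations between two modes\<close>

lemma Y_op_diff: "Y_op i (f - g) = Y_op i f - Y_op i g"
  using Y_op_add[of i "f - g" g] by simp

lemma Wstar_op_diff: "Wstar_op i (f - g) = Wstar_op i f - Wstar_op i g"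
  using Wstar_op_add[of i "f - g" g] by simp

text \<open>On 1 the expressions from \<open>Y_op_hh\<close> cancel. Inserting a factor
  \<open>Lam_p n\<close> turns the left-hand side into a combination of left-hand sides with
  \<open>i\<close> or \<open>j\<close> shifted by n, so the vanishing persists.\<close>

lemma Y_op_Y_op: "Y_op i (Y_op j f) + Y_op (j + 1) (Y_op (i - 1) f) = 0"
proof (induction f arbitrary: i j rule: Lam_induct)
  case (const c)
  have "Y_op i (Y_op j 1) + Y_op (j + 1) (Y_op (i - 1) 1) = 0"
  proof -
    have 1: "Y_op (j + 1) (hh (1 - i)) =
       hh (- 1 - j) * hh (1 - i) - (hh (- j) + hh (- 2 - j)) * hh (- i) + hh (- 1 - j) * hh (- 1 - i)"
      using Y_op_hh[of "- (j + 1)" "1 - i"]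
      by (simp add: minus_diff_commute[of _ 1] minus_diff_commute[of _ 2] add.commute[of 1 j])
    have 2: "Y_op i (hh (- j)) =
       hh (- i) * hh (- j) - (hh (1 - i) + hh (- 1 - i)) * hh (- 1 - j) + hh (- i) * hh (- 2 - j)"
      using Y_op_hh[of "- i" "- j"] by (simp add: minus_diff_commute[of _ 1] minus_diff_commute[of _ 2])
    have "Y_op i (hh (- j)) + Y_op (j + 1) (hh (1 - i)) = 0"
      unfolding 1 2 by (simp add: algebra_simps)
    then show ?thesis by (simp add: Y_op_1)
  qed
  then show ?case
    using Y_op_const[of _ c 1] by (simp add: Y_op_const flip: distrib_left)
next
  case (add f g)
  have "Y_op i (Y_op j (f + g)) + Y_op (j + 1) (Y_op (i - 1) (f + g)) =
      (Y_op i (Y_op j f) + Y_op (j + 1) (Y_op (i - 1) f)) +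
      (Y_op i (Y_op j g) + Y_op (j + 1) (Y_op (i - 1) g))"
    by (simp add: Y_op_add)
  with add show ?case by simp
next
  case (p n f)
  have "Y_op i (Y_op j (Lam_p n * f)) + Y_op (j + 1) (Y_op (i - 1) (Lam_p n * f)) =
     Lam_p n * (Y_op i (Y_op j f) + Y_op (j + 1) (Y_op (i - 1) f))
     - (Y_op (i - int n) (Y_op j f) + Y_op (j + 1) (Y_op (i - int n - 1) f))
     - (Y_op (i + int n) (Y_op j f) + Y_op (j + 1) (Y_op (i + int n - 1) f))
     - (Y_op i (Y_op (j - int n) f) + Y_op (j - int n + 1) (Y_op (i - 1) f))
     - (Y_op i (Y_op (j + int n) f) + Y_op (j + int n + 1) (Y_op (i - 1) f))"
    unfolding Y_op_p[OF p(1)] Y_op_diff by (simp add: algebra_simps)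
  then show ?case unfolding p(2) by simp
qed

text \<open>With \<open>Q m n\<close> and \<open>Q' m n\<close> the coefficients of \<open>Y(z) W\<^sup>*(w).1\<close> and \<open>W\<^sup>*(w) Y(z).1\<close>, both
  \<open>(1 - z w) (1 - w/z) Q\<close> and \<open>(1 - z w) (1 - z/w) Q'\<close> equal \<open>H(z) / H(w)\<close>.  Cancelling \<open>1 - z w\<close>
  shows that the sum \<open>G\<close> depends on \<open>m + n\<close> only; summing the identity for \<open>Q\<close> over an
  antidiagonal telescopes and, by \<open>H(z) / H(z) = 1\<close>, determines \<open>G\<close>.\<close>

lemma Y_Wstar_1:
  "Y_op (- m) (ee n) + Wstar_op (n + 1) (hh (m - 1)) = (if m + n \<ge> 0 \<and> even (m + n) then 1 else 0)"
proof -
  define Q where "Q = (\<lambda>m n. Y_op (- m) (ee n))"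
  define Q' where "Q' = (\<lambda>m n. Wstar_op n (hh m))"
  define R where "R = (\<lambda>m n. Q m n - Q (m + 1) (n - 1))"
  define R' where "R' = (\<lambda>m n. Q' m n - Q' (m - 1) (n + 1))"
  have Qneg: "Q m n = 0" if "n < 0" for m n using that by (simp add: Q_def)
  have Q'neg: "Q' m n = 0" if "m < 0" for m n using that by (simp add: Q'_def)
  have R: "R m n - R (m - 1) (n - 1) = hh m * ee n" for m n
    using Y_op_ee[of m n] by (simp add: R_def Q_def minus_diff_commute[of m 1] algebra_simps)
  have R': "R' m n - R' (m - 1) (n - 1) = hh m * ee n" for m n
    using Wstar_op_hh[of n m] by (simp add: R'_def Q'_def algebra_simps)
  have shift: "R m n - R' m n = R (m - int k) (n - int k) - R' (m - int k) (n - int k)" for m n k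
  proof (induction k)
    case (Suc k)
    then show ?case using R[of "m - int k" "n - int k"] R'[of "m - int k" "n - int k"]
      by (simp add: algebra_simps)
  qed simp
  have RR': "R m n = R' m n" for m n
  proof -
    \<comment> \<open>Far enough down the diagonal all terms vanish: those of \<open>R\<close> have
      negative second index, those of \<open>R'\<close> negative first index.\<close>
    obtain k where "m < int k" "n < int k"
      using that[of "Suc (nat m + nat n)"] by auto
    then show ?thesis using shift[of m n k] by (simp add: R_def R'_def Qneg Q'neg)
  qed
  define G where "G = (\<lambda>m n. Q m n + Q' (m - 1) (n + 1))"
  have G_step: "G (m + 1) (n - 1) = G m n" for m n
    using RR'[of m n] by (simp add: G_def R_def R'_def algebra_simps)
  have G_shift: "G (m + int k) (n - int k) = G m n" for m n k
  proof (induction k)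
    case (Suc k)
    then show ?case using G_step[of "m + int k" "n - int k"] by (simp add: algebra_simps)
  qed simp
  \<comment> \<open>For \<open>m0 \<le> 0\<close> the \<open>Q'\<close> summand of \<open>G\<close>
    is zero, so \<open>Q\<close> alone gives the value of \<open>G\<close> on the
    antidiagonal.\<close>
  have G_eq: "G m n = Q m0 (m + n - m0)" if "m0 \<le> 0" for m n m0
  proof (cases "m0 \<le> m")
    case True
    then show ?thesis using G_shift[of m0 "nat (m - m0)" "m + n - m0"] that
      by (simp add: G_def Q'neg)
  next
    case False
    then show ?thesis using G_shift[of m "nat (m0 - m)" "n"] that
      by (simp add: G_def Q'neg algebra_simps)
  qed
  define g where "g = (\<lambda>s. Q 0 s)"
  have g: "Q (- 1) s = g (s - 1)" for s
    using G_eq[of "-1" 0 "s - 1"] G_eq[of 0 0 "s - 1"] by (simp add: g_def)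
  have telescope: "(\<Sum>m\<le>N. R (a + int m) (b - int m)) = Q a b - Q (a + int N + 1) (b - int N - 1)" for a b N
    by (induction N) (simp_all add: R_def algebra_simps)
  \<comment> \<open>Both telescoping sums end at a negative second index, where \<open>Q\<close> is
    0; only their starting terms \<open>Q 0 s\<close> and \<open>Q (- 1) (s - 1)\<close>
    remain.\<close>
  have g_rec: "g (int s) = g (int s - 2) + (if s = 0 then 1 else 0)" for s
  proof -
    have "(if s = 0 then 1 else 0) = (\<Sum>m\<le>s. R (int m) (int s - int m) - R (int m - 1) (int s - int m - 1))"
      unfolding R by (rule sum_hh_ee[symmetric])
    also have "\<dots> = (\<Sum>m\<le>s. R (0 + int m) (int s - int m)) - (\<Sum>m\<le>s. R (- 1 + int m) (int s - 1 - int m))"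
      unfolding sum_subtractf by (simp add: algebra_simps)
    also have "\<dots> = g (int s) - g (int s - 2)"
      unfolding telescope by (simp add: Qneg g g_def)
    finally show ?thesis by (simp add: algebra_simps)
  qed
  have g_eq: "g (int s) = (if even s then 1 else 0)" for s
  proof (induction s rule: less_induct)
    case (less s)
    consider "s = 0" | "s = 1" | t where "s = Suc (Suc t)" by (cases s; cases "s - 1") auto
    then show ?case
    proof cases
      case (3 t)
      then show ?thesis using g_rec[of s] less[of t] by simp
    qed (use g_rec[of s] in \<open>simp_all add: g_def Qneg\<close>)
  qed
  have "G m n = g (m + n)" using G_eq[of 0 m n] by (simp add: g_def)
  also have "\<dots> = (if m + n \<ge> 0 \<and> even (m + n) then 1 else 0)"
  proof (cases "m + n \<ge> 0")
    case True
    then show ?thesis using g_eq[of "nat (m + n)"] by (simp add: even_nat_iff)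
  qed (simp add: g_def Qneg)
  finally show ?thesis by (simp add: G_def Q_def Q'_def)
qed

text \<open>The right-hand side depends on \<open>j - i\<close> only, and the two operators shift
  with opposite signs under \<open>Lam_p n\<close>. So the correction terms at
  \<open>(i - n, j)\<close> and \<open>(i, j + n)\<close> cancel, as do the other two.\<close>

lemma Y_Wstar:
  "Y_op i (Wstar_op j f) + Wstar_op (j + 1) (Y_op (i + 1) f) = (if i \<le> j \<and> even (j - i) then f else 0)"
proof (induction f arbitrary: i j rule: Lam_induct)
  case (const c)
  have "Y_op i (Wstar_op j 1) + Wstar_op (j + 1) (Y_op (i + 1) 1) = (if i \<le> j \<and> even (j - i) then 1 else 0)"
    using Y_Wstar_1[of "- i" j]
    by (auto simp: Y_op_1 Wstar_op_1 minus_diff_commute[of i 1] add.commute)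
  then show ?case
    using Y_op_const[of _ c 1] Wstar_op_const[of _ c 1]
    by (simp add: Y_op_const Wstar_op_const flip: distrib_left)
next
  case (add f g)
  have "Y_op i (Wstar_op j (f + g)) + Wstar_op (j + 1) (Y_op (i + 1) (f + g)) =
      (Y_op i (Wstar_op j f) + Wstar_op (j + 1) (Y_op (i + 1) f)) +
      (Y_op i (Wstar_op j g) + Wstar_op (j + 1) (Y_op (i + 1) g))"
    by (simp add: Y_op_add Wstar_op_add)
  with add show ?case by simp
next
  case (p n f)
  let ?P = "\<lambda>i j. Y_op i (Wstar_op j f) + Wstar_op (j + 1) (Y_op (i + 1) f)"
  have "Y_op i (Wstar_op j (Lam_p n * f)) + Wstar_op (j + 1) (Y_op (i + 1) (Lam_p n * f)) =
     Lam_p n * ?P i j - (?P (i - int n) j - ?P i (j + int n)) - (?P (i + int n) j - ?P i (j - int n))"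
    unfolding Y_op_p[OF p(1)] Wstar_op_p[OF p(1)] Y_op_diff Y_op_add Wstar_op_diff
    by (simp add: algebra_simps)
  then show ?case unfolding p(2) by (simp add: algebra_simps)
qed


section \<open>Integrality\<close>

lemma xcoeff_simps [simp]:
  "xcoeff 0 m = 0" "xcoeff (F + G) m = xcoeff F m + xcoeff G m"
  "xcoeff (F - G) m = xcoeff F m - xcoeff G m" "xcoeff (- F) m = - xcoeff F m"
  "xcoeff (xconst c) m = (if m = 0 then c else 0)"
  "xcoeff 1 m = (if m = 0 then 1 else 0)"
  by (simp_all add: zero_xseries_def plus_xseries_def minus_xseries_def uminus_xseries_def xconst_def
      one_xseries_def)

lemma xcoeff_sum: "xcoeff (sum F S) m = (\<Sum>i\<in>S. xcoeff (F i) m)"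
  by (induction S rule: infinite_finite_induct) simp_all

lemma xcoeff_mult: "xcoeff (F * G) m = (\<Sum>(a, b) \<in> splits m. xcoeff F a * xcoeff G b)"
  by (simp add: times_xseries_def)

lemma xcoeff_of_nat_mult: "xcoeff (of_nat n * F) m = of_nat n * xcoeff F m"
  by (induction n) (simp_all add: distrib_right)

lemma xseries_of_nat_cancel:
  fixes F G :: "rat xseries"
  assumes "of_nat n * F = of_nat n * G" "n > 0"
  shows "F = G"
proof (rule xseries_eqI)
  fix m
  have "of_nat n * xcoeff F m = of_nat n * xcoeff G m"
    using assms(1) by (metis xcoeff_of_nat_mult)
  with assms(2) show "xcoeff F m = xcoeff G m" by simp
qed

lemma xcoeff_xconst_mult: "xcoeff (xconst c * F) m = c * xcoeff F m"
proof -
  have "xcoeff (xconst c * F) m = (\<Sum>u \<in> splits m. (if fst u = 0 then c else 0) * xcoeff F (snd u))"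
    by (simp add: xcoeff_mult case_prod_unfold)
  also have "\<dots> = (\<Sum>u \<in> {(0 :: nat \<Rightarrow>\<^sub>0 nat, m)}. (if fst u = 0 then c else 0) * xcoeff F (snd u))"
    by (rule sum.mono_neutral_right) (use finite_splits in \<open>auto simp: splits_def\<close>)
  finally show ?thesis by simp
qed

lemma xconst_add: "xconst (a + b) = xconst a + xconst b"
  by (rule xseries_eqI) simp

lemma xconst_0: "xconst 0 = 0"
  by (rule xseries_eqI) simp

lemma xconst_1: "xconst 1 = 1"
  by (rule xseries_eqI) simp

text \<open>A splitting of \<open>m\<close> whose first half is the k-th power of a single variable
  is determined by that variable, as k is positive. Variables of \<open>I\<close> outside the
  support contribute 0, so \<open>I\<close> can be chosen freely.\<close>

lemma xcoeff_power_sum_mult: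
  assumes "k \<ge> 1" "finite I" "Poly_Mapping.keys m \<subseteq> I"
  shows "xcoeff (power_sum k * F) m =
    (\<Sum>i\<in>I. if k \<le> Poly_Mapping.lookup m i then xcoeff F (m - Poly_Mapping.single i k) else 0)"
proof -
  let ?I = "{i\<in>I. k \<le> Poly_Mapping.lookup m i}"
  let ?g = "\<lambda>i. (Poly_Mapping.single i k, m - Poly_Mapping.single i k)"
  have split: "Poly_Mapping.single i k + (m - Poly_Mapping.single i k) = m"
    if "k \<le> Poly_Mapping.lookup m i" for i
    using that by (intro poly_mapping_eqI) (auto simp: lookup_add lookup_minus lookup_single when_def)
  have "xcoeff (power_sum k * F) m =
     (\<Sum>u \<in> splits m. (if \<exists>i. fst u = Poly_Mapping.single i k then xcoeff F (snd u) else 0))"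
    by (simp add: xcoeff_mult power_sum_def case_prod_unfold if_distrib[of "\<lambda>x. x * _"] cong: if_cong)
  also have "\<dots> = (\<Sum>u \<in> ?g ` ?I. xcoeff F (snd u))"
  proof (rule sum.mono_neutral_cong_right)
    show "?g ` ?I \<subseteq> splits m" using split by (auto simp: splits_def)
    show "\<forall>u\<in>splits m - ?g ` ?I. (if \<exists>i. fst u = Poly_Mapping.single i k then xcoeff F (snd u) else 0) = 0"
    proof (intro ballI)
      fix u assume u: "u \<in> splits m - ?g ` ?I"
      have "\<nexists>i. fst u = Poly_Mapping.single i k"
      proof
        assume "\<exists>i. fst u = Poly_Mapping.single i k"
        then obtain i where i: "fst u = Poly_Mapping.single i k" ..
        with u have m: "m = Poly_Mapping.single i k + snd u" by (auto simp: splits_def)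
        then have "k \<le> Poly_Mapping.lookup m i" by (simp add: lookup_add)
        moreover from this have "i \<in> I" using assms by (auto simp: in_keys_iff)
        moreover have "u = ?g i" using i m by (cases u) simp
        ultimately show False using u by blast
      qed
      then show "(if \<exists>i. fst u = Poly_Mapping.single i k then xcoeff F (snd u) else 0) = 0" by simp
    qed
  qed (auto simp: finite_splits)
  also have "\<dots> = (\<Sum>i\<in>?I. xcoeff F (m - Poly_Mapping.single i k))"
  proof (subst sum.reindex)
    show "inj_on ?g ?I"
    proof (rule inj_onI)
      fix i j assume "?g i = ?g j"
      then have "Poly_Mapping.lookup (Poly_Mapping.single i k) i = Poly_Mapping.lookup (Poly_Mapping.single j k) i"
        by simp
      then show "i = j" using assms(1) by (auto simp: lookup_single when_def split: if_splits)
    qed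
  qed simp
  also have "\<dots> = (\<Sum>i\<in>I. if k \<le> Poly_Mapping.lookup m i then xcoeff F (m - Poly_Mapping.single i k) else 0)"
    using assms(2) by (simp add: sum.inter_filter)
  finally show ?thesis .
qed

lemma expand_superset:
  assumes "finite K" "Poly_Mapping.keys f \<subseteq> K"
  shows "expand f = (\<Sum>m\<in>K. xconst (Poly_Mapping.lookup f m) *
    (\<Prod>i \<in> Poly_Mapping.keys m. power_sum (i + 1) ^ Poly_Mapping.lookup m i))"
  unfolding expand_def
  by (rule sum.mono_neutral_left) (use assms in \<open>auto simp: in_keys_iff xconst_0\<close>)

lemma expand_add: "expand (f + g) = expand f + expand g"
proof -
  let ?K = "Poly_Mapping.keys f \<union> Poly_Mapping.keys g"
  have "Poly_Mapping.keys (f + g) \<subseteq> ?K" by (rule Poly_Mapping.keys_add)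
  then show ?thesis
    by (simp add: expand_superset[of ?K] lookup_add xconst_add distrib_right sum.distrib)
qed

lemma expand_single:
  "expand (Poly_Mapping.single u c) =
    xconst c * (\<Prod>i \<in> Poly_Mapping.keys u. power_sum (i + 1) ^ Poly_Mapping.lookup u i)"
  by (subst expand_superset[of "{u}"]) auto

lemma expand_const: "expand (Lam_const c) = xconst c"
  by (simp add: Lam_const_def expand_single)

lemma expand_p_mult:
  assumes "k \<ge> 1"
  shows "expand (Lam_p k * f) = power_sum k * expand f"
proof (induction f rule: Lam_monomial_induct)
  case (single u c)
  define i where "i = k - 1"
  then have k: "k = i + 1" using assms by simp
  let ?u = "Poly_Mapping.single i 1 + u"
  let ?K = "insert i (Poly_Mapping.keys u)"
  have "(\<Prod>j \<in> Poly_Mapping.keys ?u. power_sum (j + 1) ^ Poly_Mapping.lookup ?u j :: rat xseries)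
     = (\<Prod>j \<in> ?K. power_sum (j + 1) ^ Poly_Mapping.lookup ?u j)"
    by (rule prod.mono_neutral_left)
      (auto simp: in_keys_iff lookup_add lookup_single when_def split: if_splits)
  also have "\<dots> = (\<Prod>j \<in> ?K. (if j = i then power_sum (i + 1) else 1) * power_sum (j + 1) ^ Poly_Mapping.lookup u j)"
    by (rule prod.cong) (auto simp: lookup_add lookup_single)
  also have "\<dots> = power_sum (i + 1) * (\<Prod>j \<in> ?K. power_sum (j + 1) ^ Poly_Mapping.lookup u j)"
    by (simp add: prod.distrib)
  also have "(\<Prod>j \<in> ?K. power_sum (j + 1) ^ Poly_Mapping.lookup u j)
    = (\<Prod>j \<in> Poly_Mapping.keys u. power_sum (j + 1) ^ Poly_Mapping.lookup u j)"
    by (rule prod.mono_neutral_right) (auto simp: in_keys_iff)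
  finally show ?case
    by (simp add: Lam_p_times_single expand_single k mult_ac)
next
  case (add f g)
  then show ?case by (simp add: expand_add distrib_left)
qed

lemma expand_mult: "expand (f * g) = expand f * expand g"
proof (induction f rule: Lam_induct)
  case (const c)
  show ?case
  proof (induction g rule: Lam_induct)
    case (const d)
    show ?case
      by (rule xseries_eqI) (simp add: expand_const xcoeff_xconst_mult flip: Lam_const_mult)
  next
    case (add f g)
    then show ?case by (simp add: expand_add distrib_left)
  next
    case (p n f)
    have "expand (Lam_const c * (Lam_p n * f)) = expand (Lam_p n * (Lam_const c * f))"
      by (simp add: mult_ac)
    then show ?case by (simp only: expand_p_mult[OF p(1)] p(2)) (simp only: mult_ac)
  qed
next
  case (add f h)
  then show ?case by (simp add: expand_add distrib_right)
next
  case (p n f)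
  then show ?case by (simp add: expand_p_mult mult.assoc)
qed

lemma expand_minus: "expand (- f) = - expand f"
  using expand_add[of f "- f"] expand_const[of 0] by (simp add: xconst_0 eq_neg_iff_add_eq_0 add.commute)

lemma Lam_Z_0: "0 \<in> Lam_Z"
  and Lam_Z_1: "1 \<in> Lam_Z"
  using expand_const[of 0] expand_const[of 1] by (simp_all add: Lam_Z_def)

lemma Lam_Z_add: "f \<in> Lam_Z \<Longrightarrow> g \<in> Lam_Z \<Longrightarrow> f + g \<in> Lam_Z"
  by (simp add: Lam_Z_def expand_add)

lemma Lam_Z_minus: "f \<in> Lam_Z \<Longrightarrow> - f \<in> Lam_Z"
  by (simp add: Lam_Z_def expand_minus)

lemma Lam_Z_diff: "f \<in> Lam_Z \<Longrightarrow> g \<in> Lam_Z \<Longrightarrow> f - g \<in> Lam_Z"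
  using Lam_Z_add[of f "- g"] Lam_Z_minus by simp

lemma Lam_Z_sum: "(\<And>i. i \<in> S \<Longrightarrow> f i \<in> Lam_Z) \<Longrightarrow> sum f S \<in> Lam_Z"
  by (induction S rule: infinite_finite_induct) (simp_all add: Lam_Z_0 Lam_Z_add)

lemma Lam_Z_mult: "f \<in> Lam_Z \<Longrightarrow> g \<in> Lam_Z \<Longrightarrow> f * g \<in> Lam_Z"
  by (simp add: Lam_Z_def expand_mult xcoeff_mult case_prod_unfold Ints_sum)

lemma Lam_const_in_Lam_Z: "Lam_const q \<in> Lam_Z \<longleftrightarrow> q \<in> \<int>"
  by (auto simp: Lam_Z_def expand_const)

lemma Lam_Z_of_int: "of_int k \<in> Lam_Z"
proof -
  have "of_int k = Lam_const (of_int k)" by (simp add: Lam_const_def)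
  then show ?thesis by (simp add: Lam_const_in_Lam_Z)
qed

section \<open>Splitting off the first variable\<close>

definition pcons :: "nat \<Rightarrow> (nat \<Rightarrow>\<^sub>0 nat) \<Rightarrow> (nat \<Rightarrow>\<^sub>0 nat)"
  where "pcons a m = Abs_poly_mapping (case_nat a (Poly_Mapping.lookup m))"

lemma lookup_pcons: "Poly_Mapping.lookup (pcons a m) = case_nat a (Poly_Mapping.lookup m)"
proof -
  have "{i. case_nat a (Poly_Mapping.lookup m) i \<noteq> 0} \<subseteq> insert 0 (Suc ` Poly_Mapping.keys m)"
  proof
    fix i assume "i \<in> {i. case_nat a (Poly_Mapping.lookup m) i \<noteq> 0}"
    then show "i \<in> insert 0 (Suc ` Poly_Mapping.keys m)" by (cases i) (simp_all add: in_keys_iff)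
  qed
  then have "finite {i. case_nat a (Poly_Mapping.lookup m) i \<noteq> 0}"
    by (rule finite_subset) simp
  then show ?thesis by (simp add: pcons_def)
qed

lemma pcons_eq_0_iff: "pcons a m = 0 \<longleftrightarrow> a = 0 \<and> m = 0"
  by (auto simp: poly_mapping_eq_iff fun_eq_iff lookup_pcons split: nat.splits)

lemma keys_pcons: "Poly_Mapping.keys (pcons a m) \<subseteq> insert 0 (Suc ` Poly_Mapping.keys m)"
proof
  fix i assume "i \<in> Poly_Mapping.keys (pcons a m)"
  then show "i \<in> insert 0 (Suc ` Poly_Mapping.keys m)" by (cases i) (simp_all add: in_keys_iff lookup_pcons)
qed

lemma pcons_minus_single_0: "pcons a m - Poly_Mapping.single 0 k = pcons (a - k) m"
  by (rule poly_mapping_eqI) (simp add: lookup_pcons lookup_minus lookup_single split: nat.split)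

lemma pcons_minus_single_Suc:
  "pcons a m - Poly_Mapping.single (Suc i) k = pcons a (m - Poly_Mapping.single i k)"
  by (rule poly_mapping_eqI) (simp add: lookup_pcons lookup_minus lookup_single when_def split: nat.split)

text \<open>Removing the first variable and renumbering moves the support down by one, so finitely
  many removals exhaust it.\<close>

lemma pcons_induct [case_names zero pcons]:
  assumes zero: "P 0" and pcons: "\<And>a m. P m \<Longrightarrow> P (pcons a m)"
  shows "P m"
proof -
  obtain N where "Poly_Mapping.keys m \<subseteq> {..<N}"
    using finite_nat_bounded[OF finite_keys] by auto
  then show ?thesis
  proof (induction N arbitrary: m)
    case 0
    then show ?case using zero by simp
  next
    case (Suc N)
    define t where "t = Poly_Mapping.map_key Suc m"
    have lt: "Poly_Mapping.lookup t i = Poly_Mapping.lookup m (Suc i)" for i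
      by (simp add: t_def map_key.rep_eq)
    have "Poly_Mapping.keys t \<subseteq> {..<N}"
    proof
      fix i assume "i \<in> Poly_Mapping.keys t"
      then have "Suc i \<in> Poly_Mapping.keys m" by (simp add: in_keys_iff lt)
      with Suc.prems show "i \<in> {..<N}" by auto
    qed
    moreover have "m = pcons (Poly_Mapping.lookup m 0) t"
      by (rule poly_mapping_eqI) (simp add: lookup_pcons lt split: nat.split)
    ultimately show ?case using pcons[OF Suc.IH[of t], of "Poly_Mapping.lookup m 0"] by simp
  qed
qed

text \<open>The coefficient of \<open>x\<^sub>0\<^sup>a\<close>, as a series in the remaining variables renumbered from \<open>0\<close>.\<close>

definition head_coeff :: "int \<Rightarrow> rat xseries \<Rightarrow> rat xseries"
  where "head_coeff a F = (if a < 0 then 0 else Xseries (\<lambda>m. xcoeff F (pcons (nat a) m)))"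

lemma xcoeff_head_coeff: "xcoeff (head_coeff a F) m = (if a < 0 then 0 else xcoeff F (pcons (nat a) m))"
  by (simp add: head_coeff_def)

lemma head_coeff_add: "head_coeff a (F + G) = head_coeff a F + head_coeff a G"
  and head_coeff_minus: "head_coeff a (- F) = - head_coeff a F"
  and head_coeff_0: "head_coeff a 0 = 0"
  and head_coeff_xconst: "head_coeff a (xconst c) = (if a = 0 then xconst c else 0)"
  by (auto intro!: xseries_eqI simp: xcoeff_head_coeff pcons_eq_0_iff)

lemma head_coeff_sum: "head_coeff a (sum F S) = (\<Sum>i\<in>S. head_coeff a (F i))"
  by (induction S rule: infinite_finite_induct) (simp_all add: head_coeff_0 head_coeff_add)

lemma head_coeff_of_nat: "head_coeff a (of_nat n * F) = of_nat n * head_coeff a F"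
  by (induction n) (simp_all add: distrib_right head_coeff_0 head_coeff_add)

text \<open>A power sum is x_0^k plus the same power sum in the remaining variables. Setting
  \<open>head_coeff\<close> to 0 at negative exponents makes the rule uniform in
  \<open>a\<close>.\<close>

lemma head_coeff_power_sum:
  assumes "k \<ge> 1"
  shows "head_coeff a (power_sum k * F) = power_sum k * head_coeff a F + head_coeff (a - int k) F"
proof (cases "a < 0")
  case True
  then show ?thesis by (auto intro!: xseries_eqI simp: head_coeff_def)
next
  case False
  then obtain b where a: "a = int b" by (metis nonneg_int_cases not_less)
  show ?thesis
  proof (rule xseries_eqI)
    fix m
    let ?l = Poly_Mapping.lookup
    let ?s = "\<lambda>i. Poly_Mapping.single i k"
    have "xcoeff (head_coeff a (power_sum k * F)) m = xcoeff (power_sum k * F) (pcons b m)"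
      by (simp add: xcoeff_head_coeff a)
    also have "\<dots> = (\<Sum>i\<in>insert 0 (Suc ` Poly_Mapping.keys m).
        if k \<le> ?l (pcons b m) i then xcoeff F (pcons b m - ?s i) else 0)"
      by (rule xcoeff_power_sum_mult) (use assms keys_pcons in auto)
    also have "\<dots> = (if k \<le> b then xcoeff F (pcons (b - k) m) else 0) +
        (\<Sum>i\<in>Poly_Mapping.keys m. if k \<le> ?l m i then xcoeff F (pcons b (m - ?s i)) else 0)"
      by (simp add: sum.reindex lookup_pcons pcons_minus_single_0 pcons_minus_single_Suc cong: if_cong)
    also have "(\<Sum>i\<in>Poly_Mapping.keys m. if k \<le> ?l m i then xcoeff F (pcons b (m - ?s i)) else 0)
        = xcoeff (power_sum k * head_coeff a F) m"
      by (subst xcoeff_power_sum_mult[OF assms, of "Poly_Mapping.keys m"])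
        (simp_all add: xcoeff_head_coeff a cong: if_cong)
    also have "(if k \<le> b then xcoeff F (pcons (b - k) m) else 0) = xcoeff (head_coeff (a - int k) F) m"
      by (auto simp: xcoeff_head_coeff a nat_diff_distrib' simp flip: of_nat_diff)
    finally show "xcoeff (head_coeff a (power_sum k * F)) m =
        xcoeff (power_sum k * head_coeff a F + head_coeff (a - int k) F) m"
      by (simp add: add.commute)
  qed
qed

text \<open>\<open>exp_zderiv 1\<close> adjoins two further variables \<open>z\<close> and \<open>1/z\<close> to a symmetric function, so its
  coefficients are sums of coefficients of the given function.\<close>

lemma expand_exp_zderiv:
  "\<exists>N. \<forall>n\<ge>N. \<forall>a. expand (fls_nth (exp_zderiv 1 f) a) =
    (\<Sum>j\<le>n. head_coeff (a + int j) (head_coeff (int j) (expand f)))"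
proof (induction f rule: Lam_induct)
  case (const c)
  have "expand (fls_nth (exp_zderiv 1 (Lam_const c)) a) =
     (\<Sum>j\<le>n. head_coeff (a + int j) (head_coeff (int j) (expand (Lam_const c))))" for n a
  proof -
    have "(\<Sum>j\<le>n. head_coeff (a + int j) (head_coeff (int j) (xconst c))) =
      (\<Sum>j\<le>n. if j = 0 then head_coeff a (xconst c) else 0)"
      by (rule sum.cong) (auto simp: head_coeff_xconst head_coeff_0)
    then show ?thesis
      using expand_const[of 0] by (simp add: exp_zderiv_const expand_const head_coeff_xconst xconst_0)
  qed
  then show ?case by blast
next
  case (add f g)
  obtain N where N: "\<And>n a. n \<ge> N \<Longrightarrow> expand (fls_nth (exp_zderiv 1 f) a) =
      (\<Sum>j\<le>n. head_coeff (a + int j) (head_coeff (int j) (expand f)))"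
    using add(1) by blast
  obtain M where M: "\<And>n a. n \<ge> M \<Longrightarrow> expand (fls_nth (exp_zderiv 1 g) a) =
      (\<Sum>j\<le>n. head_coeff (a + int j) (head_coeff (int j) (expand g)))"
    using add(2) by blast
  show ?case
  proof (intro exI[of _ "max N M"] allI impI)
    fix n a assume "n \<ge> max N M"
    then show "expand (fls_nth (exp_zderiv 1 (f + g)) a) =
      (\<Sum>j\<le>n. head_coeff (a + int j) (head_coeff (int j) (expand (f + g))))"
      using N[of n a] M[of n a]
      by (simp add: exp_zderiv_add expand_add head_coeff_add sum.distrib)
  qed
next
  case (p k f)
  then obtain N where N: "\<And>n a. n \<ge> N \<Longrightarrow> expand (fls_nth (exp_zderiv 1 f) a) =
      (\<Sum>j\<le>n. head_coeff (a + int j) (head_coeff (int j) (expand f)))"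
    by blast
  \<comment> \<open>The bound grows by \<open>k\<close> because one of the shifted sums will be
    taken only up to \<open>n - k\<close>, which must still be at least \<open>N\<close>.\<close>
  have "expand (fls_nth (exp_zderiv 1 (Lam_p k * f)) a) =
      (\<Sum>j\<le>n. head_coeff (a + int j) (head_coeff (int j) (expand (Lam_p k * f))))"
    if n: "n \<ge> N + k" for n a
  proof -
    let ?d = "\<lambda>a j. head_coeff a (head_coeff j (expand f))"
    have "exp_zderiv 1 (Lam_p k * f) = fls_const (Lam_p k) * exp_zderiv 1 f + zeta k * exp_zderiv 1 f"
      unfolding exp_zderiv_p[OF p(1)] by (simp add: distrib_right)
    then have "expand (fls_nth (exp_zderiv 1 (Lam_p k * f)) a) =
        power_sum k * expand (fls_nth (exp_zderiv 1 f) a) +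
        (expand (fls_nth (exp_zderiv 1 f) (a + int k)) + expand (fls_nth (exp_zderiv 1 f) (a - int k)))"
      by (simp only: fls_plus_nth fls_nth_const_times fls_nth_zeta_times expand_add expand_p_mult[OF p(1)])
    also have "\<dots> = power_sum k * (\<Sum>j\<le>n. ?d (a + int j) (int j)) +
       ((\<Sum>j\<le>n - k. ?d (a + int k + int j) (int j)) + (\<Sum>j\<le>n. ?d (a - int k + int j) (int j)))"
    proof -
      have n': "n \<ge> N" "n - k \<ge> N" using n by auto
      show ?thesis by (subst N[OF n'(2), of "a + int k"]) (simp only: N[OF n'(1)])
    qed
    also have "(\<Sum>j\<le>n - k. ?d (a + int k + int j) (int j)) = (\<Sum>j\<in>{k..n}. ?d (a + int j) (int j - int k))"
      by (rule sum.reindex_bij_witness[of _ "\<lambda>j. j - k" "\<lambda>j. j + k"])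
        (use n in \<open>auto simp: of_nat_diff algebra_simps\<close>)
    \<comment> \<open>The added terms \<open>j < k\<close> ask for a negative exponent and
      vanish.\<close>
    also have "\<dots> = (\<Sum>j\<le>n. ?d (a + int j) (int j - int k))"
      by (rule sum.mono_neutral_left) (auto simp: head_coeff_def[of "int _ - int k"] head_coeff_0)
    finally show ?thesis
      unfolding expand_p_mult[OF p(1)] head_coeff_power_sum[OF p(1)] head_coeff_add
      by (simp add: sum.distrib sum_distrib_left algebra_simps)
  qed
  then show ?case by blast
qed

lemma Lam_Z_exp_zderiv:
  assumes "f \<in> Lam_Z"
  shows "fls_nth (exp_zderiv 1 f) a \<in> Lam_Z"
proof -
  obtain N where N: "\<And>n a. n \<ge> N \<Longrightarrow> expand (fls_nth (exp_zderiv 1 f) a) =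
      (\<Sum>j\<le>n. head_coeff (a + int j) (head_coeff (int j) (expand f)))"
    using expand_exp_zderiv by blast
  show ?thesis
    using assms
    by (auto simp: Lam_Z_def N[OF order_refl, of a] xcoeff_sum xcoeff_head_coeff intro!: Ints_sum)
qed

section \<open>Newton's identities and integrality of the elementary symmetric functions\<close>

lemma Eser_newton:
  "of_nat n * fps_nth Eser n = - (\<Sum>i<n. Lam_p (Suc i) * fps_nth Eser (n - Suc i))"
proof (cases n)
  case (Suc k)
  have "of_nat n * fps_nth Eser n = fps_nth (fps_deriv Eser) k" by (simp add: Suc)
  also have "\<dots> = - (\<Sum>i\<le>k. Lam_p (Suc i) * fps_nth Eser (k - i))"
    by (simp add: fps_deriv_Eser fps_mult_nth Pser_def sum_negf atLeast0AtMost)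
  finally show ?thesis by (simp add: Suc lessThan_Suc_atMost)
qed simp

lemma expand_Eser_newton:
  "of_nat n * expand (ee (int n)) = - (\<Sum>i<n. power_sum (Suc i) * expand (ee (int n - 1 - int i)))"
proof -
  have 1: "expand (of_nat n * f) = of_nat n * expand f" for f
    using expand_const[of 0] by (induction n) (simp_all add: distrib_right expand_add xconst_0)
  have 2: "expand (\<Sum>i<k. g i) = (\<Sum>i<k. expand (g i))" for k :: nat and g
    using expand_const[of 0] by (induction k) (simp_all add: expand_add xconst_0)
  have "of_nat n * expand (ee (int n)) = expand (of_nat n * fps_nth Eser n)"
    by (simp add: 1 ee_of_nat)
  also have "\<dots> = - (\<Sum>i<n. power_sum (Suc i) * expand (fps_nth Eser (n - Suc i)))"
    by (simp add: Eser_newton expand_minus 2 expand_p_mult)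
  also have "(\<Sum>i<n. power_sum (Suc i) * expand (fps_nth Eser (n - Suc i))) =
     (\<Sum>i<n. power_sum (Suc i) * expand (ee (int n - 1 - int i)))"
  proof (rule sum.cong[OF refl])
    fix i assume "i \<in> {..<n}"
    then have "int n - 1 - int i = int (n - Suc i)" by auto
    then show "power_sum (Suc i) * expand (fps_nth Eser (n - Suc i)) =
      power_sum (Suc i) * expand (ee (int n - 1 - int i))"
      by (simp only: ee_of_nat)
  qed
  finally show ?thesis .
qed

text \<open>Splitting off x_0 amounts to E(x_0, x_1, ...) = (1 - x_0 w) E(x_1, ...). As
  \<open>Eser\<close> is given through power sums, this is derived from Newton's identity by
  induction on \<open>n\<close>.\<close>

lemma head_coeff_expand_ee:
  "head_coeff a (expand (ee (int n))) =
    (if a = 0 then expand (ee (int n)) else if a = 1 then - expand (ee (int n - 1)) else 0)"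
proof (induction n arbitrary: a rule: less_induct)
  case (less n)
  have e0: "expand 0 = 0" using expand_const[of 0] by (simp add: xconst_0)
  show ?case
  proof (cases "n = 0 \<or> a < 0")
    case True
    then show ?thesis
      using head_coeff_xconst[of a 1] expand_const[of 1] e0
      by (auto simp: head_coeff_def xconst_1)
  next
    case False
    let ?x = "\<lambda>i. expand (ee i)"
    have IH: "head_coeff b (?x (int n - 1 - int i)) =
       (if b = 0 then ?x (int n - 1 - int i) else if b = 1 then - ?x (int n - 2 - int i) else 0)"
      if "i < n" for b i
    proof -
      have "int n - 1 - int i = int (n - 1 - i)" using that by auto
      moreover have "int n - 2 - int i = int (n - 1 - i) - 1" using that by auto
      ultimately show ?thesis using less[of "n - 1 - i" b] that by (simp only:)
    qed
    have "of_nat n * head_coeff a (?x (int n)) =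
       - ((\<Sum>i<n. power_sum (Suc i) * head_coeff a (?x (int n - 1 - int i)))
          + (\<Sum>i<n. head_coeff (a - 1 - int i) (?x (int n - 1 - int i))))"
      unfolding head_coeff_of_nat[symmetric] expand_Eser_newton head_coeff_minus head_coeff_sum
      by (simp add: head_coeff_power_sum sum.distrib algebra_simps)
    also have "\<dots> = of_nat n * (if a = 0 then ?x (int n) else if a = 1 then - ?x (int n - 1) else 0)"
    proof -
      consider "a = 0" | "a = 1" | b where "a = int b + 2"
      proof -
        assume *: "a = 0 \<Longrightarrow> thesis" "a = 1 \<Longrightarrow> thesis" "\<And>b. a = int b + 2 \<Longrightarrow> thesis"
        have "a = int (nat (a - 2)) + 2" if "a \<noteq> 0" "a \<noteq> 1"
          using False that by auto
        with * show thesis by metis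
      qed
      then show ?thesis
      proof cases
        case 1
        have "(\<Sum>i<n. head_coeff (a - 1 - int i) (?x (int n - 1 - int i))) = 0"
          by (rule sum.neutral) (simp add: 1 head_coeff_def)
        moreover have "(\<Sum>i<n. power_sum (Suc i) * head_coeff a (?x (int n - 1 - int i))) =
          (\<Sum>i<n. power_sum (Suc i) * ?x (int n - 1 - int i))"
          by (rule sum.cong) (simp_all add: IH 1)
        ultimately show ?thesis by (simp add: 1 expand_Eser_newton)
      next
        case 2
        obtain k where k: "n = Suc k" using False by (cases n) auto
        have "(\<Sum>i<n. head_coeff (a - 1 - int i) (?x (int n - 1 - int i))) =
          (\<Sum>i<n. if i = 0 then ?x (int n - 1) else 0)"
          by (rule sum.cong) (auto simp: IH 2)
        moreover have "(\<Sum>i<n. power_sum (Suc i) * head_coeff a (?x (int n - 1 - int i))) =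
          - (\<Sum>i<n. power_sum (Suc i) * ?x (int n - 2 - int i))"
          unfolding sum_negf[symmetric] by (rule sum.cong) (simp_all add: IH 2)
        \<comment> \<open>This is Newton's identity for \<open>k = n - 1\<close>; the surplus
          summand \<open>i = k\<close> contains \<open>ee (- 1) = 0\<close>. With the single term
          from the other sum, the multiplicity becomes \<open>k + 1 = n\<close>.\<close>
        moreover have "\<dots> = of_nat k * ?x (int k)"
          unfolding expand_Eser_newton by (simp add: k e0 algebra_simps)
        ultimately show ?thesis by (simp add: 2 k algebra_simps)
      next
        case (3 b)
        have "(\<Sum>i<n. power_sum (Suc i) * head_coeff a (?x (int n - 1 - int i))) = 0"
          by (rule sum.neutral) (simp add: IH 3)
        \<comment> \<open>Only \<open>i = b\<close> and \<open>i = b + 1\<close> leave exponent 1 or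
          0, and these two terms are opposite. If just \<open>i = b\<close> lies below
          \<open>n\<close>, then its value is \<open>ee (- 1) = 0\<close>.\<close>
        moreover have "(\<Sum>i<n. head_coeff (a - 1 - int i) (?x (int n - 1 - int i))) =
          (\<Sum>i<n. (if i = b + 1 then ?x (int n - int b - 2) else 0) - (if i = b then ?x (int n - int b - 2) else 0))"
        proof (rule sum.cong[OF refl])
          fix i assume "i \<in> {..<n}"
          then have "i < n" by simp
          note IH = IH[OF this, of "a - 1 - int i"]
          consider "i = b" | "i = b + 1" | "i \<noteq> b" "i \<noteq> b + 1" by blast
          then show "head_coeff (a - 1 - int i) (?x (int n - 1 - int i)) =
            (if i = b + 1 then ?x (int n - int b - 2) else 0) - (if i = b then ?x (int n - int b - 2) else 0)"
          proof cases
            case 1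
            have e: "int n - 2 - int i = int n - int b - 2" using 1 by simp
            show ?thesis using IH[unfolded e] e 1 \<open>a = _\<close> by simp
          next
            case 2
            have e: "int n - 1 - int i = int n - int b - 2" using 2 by simp
            show ?thesis using IH[unfolded e] e 2 \<open>a = _\<close> by simp
          next
            case 3
            then have "a - 1 - int i \<noteq> 0" "a - 1 - int i \<noteq> 1" using \<open>a = _\<close> by auto
            then show ?thesis using IH 3 by simp
          qed
        qed
        moreover have "\<dots> = (if b + 1 < n then ?x (int n - int b - 2) else 0) - (if b < n then ?x (int n - int b - 2) else 0)"
          by (simp add: sum_subtractf)
        moreover have "\<dots> = 0"
          by (auto simp: e0)
        ultimately show ?thesis by (simp add: 3)
      qed
    qed
    finally show ?thesis using xseries_of_nat_cancel False by blast
  qed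
qed

text \<open>Induction over the monomial: by \<open>head_coeff_expand_ee\<close> splitting off a
  variable leads, up to sign, to a coefficient of \<open>ee n\<close> or \<open>ee (n - 1)\<close>
  at the shorter monomial, or to 0.\<close>

lemma Lam_Z_ee: "ee i \<in> Lam_Z"
proof (cases "i < 0")
  case False
  have "xcoeff (expand (ee (int n))) m \<in> \<int>" for n m
  proof (induction m arbitrary: n rule: pcons_induct)
    case zero
    show ?case
    proof (cases "n = 0")
      case True
      then show ?thesis using expand_const[of 1] by simp
    next
      case False
      have "of_nat n * xcoeff (expand (ee (int n))) 0 =
         - (\<Sum>i<n. xcoeff (power_sum (Suc i) * expand (ee (int n - 1 - int i))) 0)"
        unfolding xcoeff_of_nat_mult[symmetric] expand_Eser_newton by (simp add: xcoeff_sum)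
      also have "\<dots> = 0"
        by (simp add: xcoeff_power_sum_mult[of _ "{}"])
      finally show ?thesis using False by simp
    qed
  next
    case (pcons a m)
    have "xcoeff (expand (ee (int n))) (pcons a m) = xcoeff (head_coeff (int a) (expand (ee (int n)))) m"
      by (simp add: xcoeff_head_coeff)
    also have "\<dots> \<in> \<int>"
    proof (cases n)
      case 0
      then show ?thesis using expand_const[of 1] by (simp add: head_coeff_xconst)
    next
      case (Suc k)
      then have "int n - 1 = int k" by simp
      then show ?thesis using pcons[of n] pcons[of k] unfolding head_coeff_expand_ee by simp
    qed
    finally show ?case .
  qed
  from this[of "nat i"] False show ?thesis by (simp add: Lam_Z_def)
qed (simp add: Lam_Z_0)

lemma Lam_Z_Wstar_op:
  assumes "f \<in> Lam_Z"
  shows "Wstar_op i f \<in> Lam_Z"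
  unfolding Wstar_op_def Wstar_series_alt fls_times_nth(2)
  by (intro Lam_Z_sum Lam_Z_mult Lam_Z_exp_zderiv assms) (simp add: Lam_Z_ee flip: ee_def)


section \<open>Charged fermions\<close>

interpretation Lam_Q: module "\<lambda>q f. Lam_const q * f"
  by unfold_locales (simp_all add: distrib_left distrib_right Lam_const_add Lam_const_mult mult.assoc)

interpretation Lam_int: module int_scale
  by (rule module_int_scale)

section \<open>Partitions and removal of the first column\<close>

definition first_part :: "nat list \<Rightarrow> nat"
  where "first_part xs = (case xs of [] \<Rightarrow> 0 | a # _ \<Rightarrow> a)"

lemma first_part_simps [simp]: "first_part [] = 0" "first_part (a # xs) = a"
  by (simp_all add: first_part_def)

lemma is_partition_Nil [simp]: "is_partition []"
  by (simp add: is_partition_def)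

text \<open>The default \<open>first_part [] = 0\<close> lets the formula cover one-row
  partitions.\<close>

lemma is_partition_Cons: "is_partition (a # xs) \<longleftrightarrow> a > 0 \<and> first_part xs \<le> a \<and> is_partition xs"
  by (cases xs) (auto simp: is_partition_def)

definition strip_column :: "nat list \<Rightarrow> nat list"
  where "strip_column xs = filter (\<lambda>x. x > 0) (map (\<lambda>x. x - 1) xs)"

lemma is_partition_strip_column:
  assumes "is_partition xs"
  shows "is_partition (strip_column xs)"
proof -
  have "sorted_wrt (\<ge>) (map (\<lambda>x. x - 1) xs)"
    using assms unfolding is_partition_def sorted_wrt_map by (auto elim: sorted_wrt_mono_rel[rotated])
  then show ?thesis by (simp add: is_partition_def strip_column_def sorted_wrt_filter)
qed

lemma sum_list_strip_column:
  "is_partition xs \<Longrightarrow> sum_list xs = length xs + sum_list (strip_column xs)"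
  by (induction xs) (auto simp: is_partition_Cons strip_column_def)

text \<open>The first entry of the conjugate counts the rows; the others are the columns of the
  diagram without its first column.\<close>

lemma conjugate_strip_column:
  assumes "is_partition xs" "xs \<noteq> []"
  shows "conjugate xs = length xs # conjugate (strip_column xs)"
proof -
  obtain a ys where xs: "xs = a # ys" using assms(2) by (cases xs) auto
  have a: "a > 0" using assms(1) by (simp add: xs is_partition_Cons)
  have le: "\<forall>x\<in>set xs. 1 \<le> x \<and> x \<le> a" using assms(1) by (auto simp: is_partition_def xs Suc_le_eq)
  let ?f = "\<lambda>xs j. length (filter (\<lambda>x. j \<le> x) xs)"
  have f1: "?f xs 1 = length xs" using le by simp
  have shift: "?f xs (Suc j) = ?f (strip_column xs) j" if "j \<ge> 1" for j
    using that by (induction xs) (auto simp: strip_column_def)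
  have "[1..<Suc a] = 1 # map Suc [1..<a]" using a by (simp add: upt_conv_Cons map_Suc_upt)
  then have "conjugate xs = length xs # map (\<lambda>j. ?f xs (Suc j)) [1..<a]"
    using f1 by (simp add: conjugate_def xs o_def)
  also have "map (\<lambda>j. ?f xs (Suc j)) [1..<a] = map (?f (strip_column xs)) [1..<a]"
    by (rule map_cong[OF refl]) (use shift in auto)
  also have "\<dots> = conjugate (strip_column xs)"
  proof (cases "a = 1")
    case True
    then have "strip_column xs = []" using le by (auto simp: strip_column_def filter_empty_conv)
    then show ?thesis by (simp add: True conjugate_def)
  next
    case False
    then have "strip_column xs = (a - 1) # strip_column ys" using a by (simp add: strip_column_def xs)
    moreover have "[1..<Suc (a - 1)] = [1..<a]" using a by simp
    ultimately show ?thesis by (simp only: conjugate_def list.case)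
  qed
  finally show ?thesis .
qed

section \<open>Newton's identity for \<open>hh\<close> and abstract fermion pairs\<close>

lemma Lam_const_of_int: "Lam_const (of_int k) = of_int k"
  by (simp add: Lam_const_def)

lemma Lam_p_newton:
  assumes "n \<ge> 1"
  shows "Lam_p n = of_nat n * hh (int n) - (\<Sum>k\<in>{1..<n}. Lam_p k * hh (int (n - k)))"
proof -
  obtain m where n: "n = Suc m" using assms by (cases n) auto
  have "of_nat n * hh (int n) = fps_nth (fps_deriv Hser) m" by (simp add: n hh_of_nat del: of_nat_Suc)
  also have "\<dots> = (\<Sum>i=0..m. Lam_p (Suc i) * hh (int (m - i)))"
    by (simp add: fps_deriv_Hser fps_mult_nth Pser_def hh_of_nat del: of_nat_diff)
  also have "\<dots> = (\<Sum>k=1..n. Lam_p k * hh (int (n - k)))"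
    by (rule sum.reindex_bij_witness[of _ "\<lambda>k. k - 1" Suc]) (auto simp: n)
  also have "{1..n} = insert n {1..<n}" using assms by auto
  finally show ?thesis by simp
qed

text \<open>The relations are oriented for use: \<open>BA\<close> moves \<open>B\<close> to the
  right towards 1, \<open>A_p\<close> moves a power sum inwards. \<open>hh_in_span\<close> feeds the
  spanning argument and \<open>B_int\<close> the integrality of coefficients.\<close>

locale fermion_pair =
  fixes A B :: "int \<Rightarrow> Lam \<Rightarrow> Lam"
  assumes A_add: "A i (f + g) = A i f + A i g"
    and B_add: "B i (f + g) = B i f + B i g"
    and A_const: "A i (Lam_const q * f) = Lam_const q * A i f"
    and B_const: "B i (Lam_const q * f) = Lam_const q * B i f"
    and BA: "B j (A i f) = (if i = j then f else 0) - A (i - 1) (B (j - 1) f)"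
    and AA: "A i (A j f) = - A (j + 1) (A (i - 1) f)"
    and A_vac: "i \<ge> 0 \<Longrightarrow> A i 1 = (if i = 0 then 1 else 0)"
    and B_vac: "i \<le> 0 \<Longrightarrow> B i 1 = (if i = 0 then 1 else 0)"
    and A_p: "n \<ge> 1 \<Longrightarrow> Lam_p n * A i f = A i (Lam_p n * f) + A (i - int n) f + A (i + int n) f"
    and hh_in_span: "hh (int n) \<in> Lam_Q.span (range (\<lambda>i. A i 1))"
    and B_int: "f \<in> Lam_Z \<Longrightarrow> B i f \<in> Lam_Z"
begin

lemma A_0: "A i 0 = 0" and B_0: "B i 0 = 0"
  using A_add[of i 0 0] B_add[of i 0 0] by simp_all

lemma A_minus: "A i (- f) = - A i f" and B_minus: "B i (- f) = - B i f"
  using A_add[of i f "- f"] B_add[of i f "- f"] by (simp_all add: A_0 B_0 eq_neg_iff_add_eq_0 add.commute)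

lemma A_sign: "A i ((- 1) ^ k * f) = (- 1) ^ k * A i f"
  and B_sign: "B i ((- 1) ^ k * f) = (- 1) ^ k * B i f"
  by (induction k) (simp_all add: A_minus B_minus)

lemma B_sum: "B i (sum f S) = (\<Sum>x\<in>S. B i (f x))"
  by (induction S rule: infinite_finite_induct) (simp_all add: B_0 B_add)

section \<open>Words indexed by partitions and the conjugation formula\<close>

definition T :: "nat list \<Rightarrow> Lam"
  where "T xs = op_word A (map (\<lambda>a. - int a) xs)"

lemma T_Nil [simp]: "T [] = 1" and T_Cons: "T (a # xs) = A (- int a) (T xs)"
  by (simp_all add: T_def op_word_def)

text \<open>Moving \<open>B\<^sub>l\<close> to the right through \<open>l\<close> factors lengthens every row by one; the contraction
  terms vanish since the indices have different signs.\<close>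

lemma B_add_column:
  assumes "\<forall>x\<in>set xs. x > 0"
  shows "B (int (length xs)) (T (map (\<lambda>x. x - 1) xs)) = (- 1) ^ length xs * T xs"
  using assms
proof (induction xs)
  case Nil
  then show ?case by (simp add: B_vac)
next
  case (Cons x xs)
  then have "- int (x - 1) - 1 = - int x" "- int (x - 1) \<noteq> int (Suc (length xs))" by auto
  then show ?case using Cons by (simp add: T_Cons BA del: of_nat_Suc) (simp add: A_sign)
qed

text \<open>Zeros in a weakly decreasing list are at its end, next to 1, and \<open>A 0\<close>
  fixes 1.\<close>

lemma T_filter_pos:
  assumes "sorted_wrt (\<ge>) xs"
  shows "T (filter (\<lambda>x. x > 0) xs) = T xs"
  using assms
proof (induction xs)
  case (Cons x xs)
  show ?case
  proof (cases "x = 0")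
    case True
    with Cons have "filter (\<lambda>x. x > 0) xs = []" by (auto simp: filter_empty_conv)
    with Cons True have "T xs = 1" by simp
    with True \<open>filter _ xs = []\<close> show ?thesis by (simp add: T_Cons A_vac)
  qed (use Cons in \<open>simp add: T_Cons\<close>)
qed simp

text \<open>\<open>B_add_column\<close> restores the removed column; rows that became empty may be
  dropped by \<open>T_filter_pos\<close>.\<close>

lemma T_strip_column:
  assumes "is_partition xs"
  shows "T xs = (- 1) ^ length xs * B (int (length xs)) (T (strip_column xs))"
proof -
  have "sorted_wrt (\<ge>) (map (\<lambda>x. x - 1) xs)"
    using assms unfolding is_partition_def sorted_wrt_map by (auto elim: sorted_wrt_mono_rel[rotated])
  then have "B (int (length xs)) (T (strip_column xs)) = (- 1) ^ length xs * T xs"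
    using assms B_add_column[of xs] by (simp add: strip_column_def T_filter_pos is_partition_def)
  then show ?thesis by (simp add: mult.assoc[symmetric] flip: power_mult_distrib)
qed

text \<open>Columns are peeled off one by one; the signs, one for each box of a column, multiply to
  that of the size.\<close>

lemma T_conjugate:
  "is_partition xs \<Longrightarrow> T xs = (- 1) ^ sum_list xs * op_word B (map int (conjugate xs))"
proof (induction "sum_list xs" arbitrary: xs rule: less_induct)
  case less
  show ?case
  proof (cases "xs = []")
    case True
    then show ?thesis by (simp add: conjugate_def op_word_def)
  next
    case False
    let ?ys = "strip_column xs"
    have s: "sum_list xs = length xs + sum_list ?ys"
      using less.prems by (rule sum_list_strip_column)
    with False have "sum_list ?ys < sum_list xs" by simp
    then have "T ?ys = (- 1) ^ sum_list ?ys * op_word B (map int (conjugate ?ys))"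
      using is_partition_strip_column[OF less.prems] by (rule less.hyps)
    then show ?thesis
      unfolding T_strip_column[OF less.prems] conjugate_strip_column[OF less.prems False] s
      by (simp add: B_sign op_word_def power_add mult.assoc)
  qed
qed

section \<open>Integrality of the words and extraction of coefficients\<close>

lemma op_word_B_in_Lam_Z: "op_word B is \<in> Lam_Z"
  by (induction "is") (simp_all add: op_word_def Lam_Z_1 B_int)

text \<open>Conjugation rewrites the word, up to sign, as a word in \<open>B\<close>, which
  preserves \<open>Lam_Z\<close>.\<close>

lemma T_in_Lam_Z: "is_partition xs \<Longrightarrow> T xs \<in> Lam_Z"
  using Lam_Z_of_int[of "(- 1) ^ sum_list xs"]
  by (simp add: T_conjugate Lam_Z_mult op_word_B_in_Lam_Z)

text \<open>On its way to the right the index of \<open>B\<close> only decreases from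
  \<open>- m\<close>, so it never meets a part of equal size; at the end a \<open>B\<close> of
  negative index annihilates 1.\<close>

lemma B_T_eq_0:
  assumes "is_partition xs" "first_part xs < m"
  shows "B (- int m) (T xs) = 0"
  using assms
proof (induction xs arbitrary: m)
  case Nil
  then show ?case by (simp add: B_vac)
next
  case (Cons a xs)
  have "B (- int (Suc m)) (T xs) = 0" by (rule Cons.IH) (use Cons.prems in \<open>auto simp: is_partition_Cons\<close>)
  moreover have "- int m - 1 = - int (Suc m)" by simp
  ultimately show ?case using Cons.prems by (simp only: T_Cons BA) (simp add: A_0)
qed

lemma B_strip_row:
  assumes "is_partition (m # xs)"
  shows "B (- int m) (T (m # xs)) = T xs"
proof -
  have "B (- int (Suc m)) (T xs) = 0" by (rule B_T_eq_0) (use assms in \<open>auto simp: is_partition_Cons\<close>)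
  moreover have "- int m - 1 = - int (Suc m)" by simp
  ultimately show ?thesis by (simp only: T_Cons BA) (simp add: A_0)
qed

text \<open>For the largest first row \<open>m\<close> occurring in the sum, \<open>B\<^bsub>-m\<^esub>\<close> removes this row and kills all
  terms with a shorter first row, so coefficients can be extracted without leaving \<open>S\<close>.\<close>

lemma coeffs_in_closed_set:
  assumes add: "\<And>f g. f \<in> S \<Longrightarrow> g \<in> S \<Longrightarrow> f + g \<in> S"
    and minus: "\<And>f. f \<in> S \<Longrightarrow> - f \<in> S" and zero: "0 \<in> S"
    and B: "\<And>i f. f \<in> S \<Longrightarrow> B i f \<in> S"
    and T: "\<And>q xs. Lam_const q \<in> S \<Longrightarrow> is_partition xs \<Longrightarrow> Lam_const q * T xs \<in> S"
    and "finite F" "F \<subseteq> {xs. is_partition xs}" "(\<Sum>xs\<in>F. Lam_const (c xs) * T xs) \<in> S" "xs \<in> F"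
  shows "Lam_const (c xs) \<in> S"
  using assms(6-9)
\<comment> \<open>The measure counts words and rows together. It drops when each word of
  \<open>F1\<close> loses its first row, and also when \<open>F1\<close> is discarded from
  \<open>F\<close>.\<close>
proof (induction "\<Sum>xs\<in>F. Suc (length xs)" arbitrary: F c xs rule: less_induct)
  case less
  have sum: "sum f X \<in> S" if "\<And>x. x \<in> X \<Longrightarrow> f x \<in> S" for f and X :: "nat list set"
    using that by (induction X rule: infinite_finite_induct) (auto simp: zero add)
  define m where "m = Max (first_part ` F)"
  have le_m: "first_part ys \<le> m" if "ys \<in> F" for ys
    unfolding m_def using less.prems that by (intro Max_ge) auto
  have "m \<in> first_part ` F"
    unfolding m_def using less.prems by (intro Max_in) auto
  then obtain zs where zs: "zs \<in> F" "first_part zs = m" by auto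
  show ?case
  proof (cases "m = 0")
    case True
    have "F \<subseteq> {[]}"
    proof
      fix ys assume "ys \<in> F"
      with le_m[of ys] True less.prems(2) show "ys \<in> {[]}" by (cases ys) (auto simp: is_partition_Cons)
    qed
    with less.prems(4) have "F = {[]}" "xs = []" by auto
    with less.prems(3) show ?thesis by simp
  next
    case False
    define F1 where "F1 = {ys \<in> F. first_part ys = m}"
    define G where "G = {ys. m # ys \<in> F}"
    have F1: "F1 = (#) m ` G"
    proof
      show "F1 \<subseteq> (#) m ` G"
      proof
        fix ys assume "ys \<in> F1"
        with False show "ys \<in> (#) m ` G" by (cases ys) (auto simp: F1_def G_def)
      qed
    qed (auto simp: F1_def G_def)
    have finF1: "finite F1" "F1 \<subseteq> F" using less.prems(1) by (auto simp: F1_def)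
    have finG: "finite G" using finF1(1) unfolding F1 by (rule finite_imageD) simp
    have "B (- int m) (\<Sum>ys\<in>F. Lam_const (c ys) * T ys) =
      (\<Sum>ys\<in>F. Lam_const (c ys) * B (- int m) (T ys))"
      by (simp add: B_sum B_const)
    also have "\<dots> = (\<Sum>ys\<in>F1. Lam_const (c ys) * B (- int m) (T ys))"
    proof (rule sum.mono_neutral_right[OF less.prems(1) finF1(2)], intro ballI)
      fix ys assume "ys \<in> F - F1"
      then have "first_part ys < m" "is_partition ys"
        using le_m[of ys] less.prems(2) by (auto simp: F1_def)
      then show "Lam_const (c ys) * B (- int m) (T ys) = 0" by (simp add: B_T_eq_0)
    qed
    also have "\<dots> = (\<Sum>ys\<in>G. Lam_const (c (m # ys)) * T ys)"
      unfolding F1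
    proof (subst sum.reindex)
      show "sum ((\<lambda>ys. Lam_const (c ys) * B (- int m) (T ys)) \<circ> (#) m) G =
         (\<Sum>ys\<in>G. Lam_const (c (m # ys)) * T ys)"
        using less.prems(2) by (intro sum.cong) (auto simp: G_def B_strip_row)
    qed simp
    finally have G_sum: "(\<Sum>ys\<in>G. Lam_const (c (m # ys)) * T ys) \<in> S"
      using B[OF less.prems(3), of "- int m"] by simp
    have "(\<Sum>ys\<in>G. Suc (length ys)) < (\<Sum>ys\<in>F1. Suc (length ys))"
    proof -
      have "(\<Sum>ys\<in>F1. Suc (length ys)) = (\<Sum>ys\<in>G. Suc (Suc (length ys)))"
        unfolding F1 by (simp add: sum.reindex)
      moreover have "G \<noteq> {}" using zs F1 by (auto simp: F1_def)
      ultimately show ?thesis using finG by (simp only:) (intro sum_strict_mono, auto)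
    qed
    also have "\<dots> \<le> (\<Sum>ys\<in>F. Suc (length ys))"
      using less.prems(1) finF1(2) by (intro sum_mono2) auto
    finally have measure: "(\<Sum>ys\<in>G. Suc (length ys)) < (\<Sum>ys\<in>F. Suc (length ys))" .
    have "G \<subseteq> {xs. is_partition xs}"
      using less.prems(2) by (auto simp: G_def is_partition_Cons)
    from less.hyps[OF measure finG this G_sum]
    have "Lam_const (c (m # ys)) \<in> S" if "ys \<in> G" for ys
      using that .
    then have F1_in: "Lam_const (c ys) \<in> S" if "ys \<in> F1" for ys
      using that unfolding F1 by auto
    show ?thesis
    proof (cases "xs \<in> F1")
      case True
      then show ?thesis by (rule F1_in)
    next
      case False
      \<comment> \<open>The coefficients on \<open>F1\<close> are now known to lie in
        \<open>S\<close>, so this part can be subtracted and the induction applied to the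
        rest.\<close>
      have "(\<Sum>ys\<in>F1. Lam_const (c ys) * T ys) \<in> S"
        using F1_in finF1(2) less.prems(2) by (intro sum T) auto
      then have "(\<Sum>ys\<in>F. Lam_const (c ys) * T ys) + - (\<Sum>ys\<in>F1. Lam_const (c ys) * T ys) \<in> S"
        by (intro add minus less.prems(3))
      then have diff: "(\<Sum>ys\<in>F - F1. Lam_const (c ys) * T ys) \<in> S"
        using less.prems(1) finF1(2) by (simp add: sum_diff)
      have "(\<Sum>ys\<in>F - F1. Suc (length ys)) < (\<Sum>ys\<in>F. Suc (length ys))"
        using zs less.prems(1) by (intro sum_strict_mono2[of F "F - F1" zs]) (auto simp: F1_def)
      then show ?thesis
        by (rule less.hyps) (use less.prems diff False in auto)
    qed
  qed
qed

lemma T_independent: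
  assumes "finite F" "F \<subseteq> {xs. is_partition xs}" "(\<Sum>xs\<in>F. Lam_const (c xs) * T xs) = 0" "xs \<in> F"
  shows "c xs = 0"
proof -
  have "Lam_const (c xs) \<in> {0}"
    by (rule coeffs_in_closed_set[of "{0}" F]) (use assms in \<open>auto simp: B_0\<close>)
  then have "Poly_Mapping.lookup (Lam_const (c xs)) 0 = 0" by simp
  then show ?thesis by (simp add: Lam_const_def)
qed

text \<open>The closed set is \<open>Lam_Z\<close> itself, whose constants are exactly the
  integers.\<close>

lemma T_coeffs_integral:
  assumes "finite F" "F \<subseteq> {xs. is_partition xs}" "(\<Sum>xs\<in>F. Lam_const (c xs) * T xs) \<in> Lam_Z" "xs \<in> F"
  shows "c xs \<in> \<int>"
proof -
  have "Lam_const (c xs) \<in> Lam_Z"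
    by (rule coeffs_in_closed_set[of Lam_Z F])
      (use assms in \<open>auto simp: Lam_Z_add Lam_Z_minus Lam_Z_0 B_int Lam_Z_mult T_in_Lam_Z\<close>)
  then show ?thesis by (simp add: Lam_const_in_Lam_Z)
qed

lemma T_inj: "inj_on T {xs. is_partition xs}"
proof (rule inj_onI, rule ccontr)
  fix xs ys assume *: "xs \<in> {xs. is_partition xs}" "ys \<in> {xs. is_partition xs}" "T xs = T ys" "xs \<noteq> ys"
  then have "(\<Sum>zs\<in>{xs, ys}. Lam_const (if zs = xs then 1 else - 1) * T zs) = 0"
    by (simp add: Lam_const_minus)
  then have "(if xs = xs then 1 else - 1 :: rat) = 0"
    by (rule T_independent[rotated 2]) (use * in auto)
  then show False by simp
qed

text \<open>By \<open>AA\<close>, prepending a row to a partition amounts to sorting.\<close>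

lemma straighten:
  "is_partition xs \<Longrightarrow> \<exists>ys. is_partition ys \<and> int (first_part ys) \<le> max 0 (max a (int (first_part xs) - 1)) \<and>
     (A (- a) (T xs) = 0 \<or> A (- a) (T xs) = T ys \<or> A (- a) (T xs) = - T ys)"
proof (induction xs arbitrary: a)
  case Nil
  show ?case
  proof (cases "a > 0")
    case True
    then show ?thesis by (intro exI[of _ "[nat a]"]) (simp add: is_partition_Cons T_Cons)
  qed (auto simp: A_vac intro: exI[of _ "[]"])
next
  case (Cons b xs)
  then have b: "b > 0" "first_part xs \<le> b" "is_partition xs" by (auto simp: is_partition_Cons)
  consider "a \<ge> int b" | "a = int b - 1" | "a < int b - 1" by linarith
  then show ?case
  proof cases
    case 1
    then show ?thesis using Cons.prems
      by (intro exI[of _ "nat a # b # xs"]) (auto simp: is_partition_Cons T_Cons)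
  next
    case 2
    \<comment> \<open>At \<open>a = b - 1\<close> the relation \<open>AA\<close> maps the pair of
      indices to itself.\<close>
    have "A (- a) (T (b # xs)) = - A (- a) (T (b # xs))"
      using AA[of "- a" "- int b" "T xs"] 2 by (simp add: T_Cons)
    then have "A (- a) (T (b # xs)) = 0"
      by (simp add: eq_neg_iff_add_eq_0 flip: mult_2)
    then show ?thesis using b by (intro exI[of _ "[]"]) simp
  next
    case 3
    \<comment> \<open>\<open>AA\<close> replaces the rows \<open>a\<close>, \<open>b\<close> by
      \<open>b - 1\<close>, \<open>a + 1\<close>. The inner row is inserted first, and the bound on
      \<open>first_part\<close> then allows \<open>b - 1\<close> to be put in front.\<close>
    obtain ys where ys: "is_partition ys" "int (first_part ys) \<le> max 0 (max (a + 1) (int (first_part xs) - 1))"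
      "A (- (a + 1)) (T xs) = 0 \<or> A (- (a + 1)) (T xs) = T ys \<or> A (- (a + 1)) (T xs) = - T ys"
      using Cons.IH[OF b(3), of "a + 1"] by blast
    have eq: "A (- a) (T (b # xs)) = - A (- int (b - 1)) (A (- (a + 1)) (T xs))"
      using AA[of "- a" "- int b" "T xs"] b(1) by (simp add: T_Cons of_nat_diff minus_diff_commute[of a 1])
    have le: "first_part ys \<le> b - 1" using ys(2) 3 b by (auto simp: of_nat_diff)
    \<comment> \<open>For \<open>b = 1\<close> the new row would be 0, which is no part; but then
      \<open>ys\<close> is empty and \<open>A 0\<close> fixes 1.\<close>
    have "\<exists>zs. is_partition zs \<and> first_part zs \<le> b - 1 \<and> A (- int (b - 1)) (T ys) = T zs"
    proof (cases "b = 1")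
      case True
      with le ys(1) have "ys = []" by (cases ys) (auto simp: is_partition_Cons)
      with True show ?thesis by (intro exI[of _ "[]"]) (simp add: A_vac)
    next
      case False
      then show ?thesis using le ys(1) b(1)
        by (intro exI[of _ "(b - 1) # ys"]) (auto simp: is_partition_Cons T_Cons)
    qed
    then obtain zs where zs: "is_partition zs" "first_part zs \<le> b - 1" "A (- int (b - 1)) (T ys) = T zs"
      by blast
    have "int (first_part zs) \<le> max 0 (max a (int (first_part (b # xs)) - 1))"
      using zs(2) b(1) by simp
    moreover have "A (- a) (T (b # xs)) = 0 \<or> A (- a) (T (b # xs)) = T zs \<or> A (- a) (T (b # xs)) = - T zs"
      unfolding eq using ys(3) zs(3) by (auto simp: A_0 A_minus)
    ultimately show ?thesis using zs(1) by blast
  qed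
qed

section \<open>The rational span of the partition words and the basis property\<close>

definition M :: "Lam set"
  where "M = Lam_Q.span (T ` {xs. is_partition xs})"

lemma A_in_M:
  assumes "f \<in> M"
  shows "A i f \<in> M"
  using assms unfolding M_def
proof (induction rule: Lam_Q.span_induct)
  case base
  show ?case
    by (rule Lam_Q.subspaceI)
      (auto simp: A_0 A_add A_const Lam_Q.span_zero Lam_Q.span_add Lam_Q.span_scale)
next
  case (step f)
  then obtain xs where xs: "is_partition xs" "f = T xs" by auto
  obtain ys where ys: "is_partition ys" "A i f = 0 \<or> A i f = T ys \<or> A i f = - T ys"
    using straighten[OF xs(1), of "- i"] xs(2) by auto
  have "T ys \<in> Lam_Q.span (T ` {xs. is_partition xs})"
    using ys(1) by (intro Lam_Q.span_base) simp
  with ys(2) show ?case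
    by (auto simp: Lam_Q.span_zero Lam_Q.span_neg)
qed

lemma T_in_M: "is_partition xs \<Longrightarrow> T xs \<in> M"
  unfolding M_def by (rule Lam_Q.span_base) simp

lemma hh_in_M: "hh (int n) \<in> M"
proof -
  have "Lam_Q.span (range (\<lambda>i. A i 1)) \<subseteq> M"
    unfolding M_def
  proof (rule Lam_Q.span_minimal)
    show "range (\<lambda>i. A i 1) \<subseteq> Lam_Q.span (T ` {xs. is_partition xs})"
      using A_in_M[of 1] T_in_M[of "[]"] by (auto simp: M_def)
  qed simp
  then show ?thesis using hh_in_span by blast
qed

lemma M_closed: "f \<in> M \<Longrightarrow> g \<in> M \<Longrightarrow> f + g \<in> M" "f \<in> M \<Longrightarrow> Lam_const q * f \<in> M"
  "f \<in> M \<Longrightarrow> g \<in> M \<Longrightarrow> f - g \<in> M" "(\<And>i. i \<in> I \<Longrightarrow> h i \<in> M) \<Longrightarrow> sum h I \<in> M"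
  unfolding M_def
  by (auto intro: Lam_Q.span_add Lam_Q.span_scale Lam_Q.span_diff Lam_Q.span_sum)

text \<open>Newton's identity puts p_n itself into \<open>M\<close>, using \<open>hh n\<close> and
  smaller power sums. In front of a word, \<open>A_p\<close> carries p_n inwards until it meets 1,
  and the correction terms stay in \<open>M\<close> by \<open>A_in_M\<close>.\<close>

lemma p_in_M:
  assumes "n \<ge> 1" "f \<in> M"
  shows "Lam_p n * f \<in> M"
  using assms
proof (induction n arbitrary: f rule: less_induct)
  case (less n)
  have p: "Lam_p n \<in> M"
    unfolding Lam_p_newton[OF less.prems(1)]
    using M_closed(2)[OF hh_in_M, of "of_nat n" n]
    by (intro M_closed(3,4) less.IH hh_in_M) (simp_all add: Lam_const_of_nat)
  have T: "Lam_p n * T xs \<in> M" if "is_partition xs" for xs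
    using that
  proof (induction xs)
    case (Cons a xs)
    then have "is_partition xs" by (simp add: is_partition_Cons)
    with Cons show ?case
      unfolding T_Cons A_p[OF less.prems(1)] by (intro M_closed(1) A_in_M T_in_M)
  qed (use p in simp)
  from less.prems(2) show ?case
    unfolding M_def
  proof (induction rule: Lam_Q.span_induct)
    case base
    show ?case
      by (rule Lam_Q.subspaceI)
        (auto simp: distrib_left mult.left_commute[of _ "Lam_const _"]
          Lam_Q.span_zero Lam_Q.span_add Lam_Q.span_scale)
  next
    case (step f)
    then show ?case using T by (auto simp: M_def)
  qed
qed

lemma M_UNIV: "f \<in> M"
proof (induction f rule: Lam_induct)
  case (const c)
  show ?case using M_closed(2)[OF T_in_M[of "[]"], of c] by simp
qed (auto intro: M_closed p_in_M)

text \<open>An element of \<open>Lam_Z\<close> has a rational expansion by \<open>M_UNIV\<close>,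
  whose coefficients are integers by \<open>T_coeffs_integral\<close>.\<close>

lemma T_Z_basis: "is_Z_basis {xs. is_partition xs} T Lam_Z"
  unfolding is_Z_basis_def
proof (intro conjI T_inj)
  let ?P = "{xs. is_partition xs}"
  have reindex: "\<exists>F. finite F \<and> F \<subseteq> ?P \<and> t = T ` F \<and> inj_on T F"
    if "finite t" "t \<subseteq> T ` ?P" for t
    using finite_subset_image[OF that] inj_on_subset[OF T_inj] by metis
  show "\<not> Lam_int.dependent (T ` ?P)"
    unfolding Lam_int.independent_explicit_module
  proof (intro allI impI)
    fix t u v assume *: "finite t" "t \<subseteq> T ` ?P" "(\<Sum>w\<in>t. int_scale (u w) w) = 0" "v \<in> t"
    obtain F where F: "finite F" "F \<subseteq> ?P" "t = T ` F" "inj_on T F" using reindex[OF *(1,2)] by blast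
    have "(\<Sum>xs\<in>F. Lam_const (of_int (u (T xs))) * T xs) = 0"
      using *(3) unfolding F(3) by (simp add: sum.reindex[OF F(4)] Lam_const_of_int)
    then have "(of_int (u (T xs)) :: rat) = 0" if "xs \<in> F" for xs
      using that by (rule T_independent[OF F(1,2)])
    then show "u v = 0" using *(4) F(3) by auto
  qed
  show "Lam_int.span (T ` ?P) = Lam_Z"
  proof
    show "Lam_int.span (T ` ?P) \<subseteq> Lam_Z"
      by (rule Lam_int.span_minimal)
        (auto intro!: Lam_int.subspaceI simp: T_in_Lam_Z Lam_Z_0 Lam_Z_add Lam_Z_mult Lam_Z_of_int)
    show "Lam_Z \<subseteq> Lam_int.span (T ` ?P)"
    proof
      fix f assume f: "f \<in> Lam_Z"
      from M_UNIV[of f] obtain t r where t: "finite t" "t \<subseteq> T ` ?P" "f = (\<Sum>a\<in>t. Lam_const (r a) * a)"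
        unfolding M_def Lam_Q.span_explicit by blast
      obtain F where F: "finite F" "F \<subseteq> ?P" "t = T ` F" "inj_on T F" using reindex[OF t(1,2)] by blast
      have f_eq: "f = (\<Sum>xs\<in>F. Lam_const (r (T xs)) * T xs)"
        unfolding t(3) F(3) by (simp add: sum.reindex[OF F(4)])
      show "f \<in> Lam_int.span (T ` ?P)"
        unfolding f_eq
      proof (rule Lam_int.span_sum)
        fix xs assume xs: "xs \<in> F"
        have "r (T xs) \<in> \<int>" using T_coeffs_integral[OF F(1,2), of "\<lambda>xs. r (T xs)"] f xs f_eq by simp
        then obtain k where "r (T xs) = of_int k" by (auto elim: Ints_cases)
        moreover have "int_scale k (T xs) \<in> Lam_int.span (T ` ?P)"
          using xs F(2) by (intro Lam_int.span_scale Lam_int.span_base) auto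
        ultimately show "Lam_const (r (T xs)) * T xs \<in> Lam_int.span (T ` ?P)"
          by (simp add: Lam_const_of_int)
      qed
    qed
  qed
qed

end


section \<open>The two pairs of operators\<close>

text \<open>The factor 1 - z^2 subtracts a mode shifted by 2; the direction differs because the two
  families are indexed by opposite powers of z.\<close>

lemma Ystar_op_conv: "Ystar_op i f = Wstar_op i f - Wstar_op (i - 2) f"
  and W_op_conv: "W_op i f = Y_op i f - Y_op (i + 2) f"
proof -
  have "fls_nth ((1 - fls_X ^ 2) * F) j = fls_nth F j - fls_nth F (j - 2)" for F :: "Lam fls" and j
    using fls_X_power_times_conv_shift(1)[of 2 F] by (simp add: left_diff_distrib)
  then show "Ystar_op i f = Wstar_op i f - Wstar_op (i - 2) f" "W_op i f = Y_op i f - Y_op (i + 2) f"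
    by (simp_all add: Ystar_op_def Wstar_op_def Ystar_series_def W_op_def Y_op_def W_series_def
      minus_diff_commute[of i 2])
qed

lemma Wstar_Y:
  "Wstar_op j (Y_op i f) =
    (if i \<le> j \<and> even (j - i) then f else 0) - Y_op (i - 1) (Wstar_op (j - 1) f)"
  using Y_Wstar[of "i - 1" "j - 1" f] by (simp add: algebra_simps)

interpretation Y: fermion_pair Y_op Ystar_op
proof
  show "Ystar_op j (Y_op i f) = (if i = j then f else 0) - Y_op (i - 1) (Ystar_op (j - 1) f)" for i j f
  proof -
    \<comment> \<open>The factor 1 - z^2 cancels all even positive differences \<open>j - i\<close>,
      leaving the Kronecker delta.\<close>
    have "(if i \<le> j \<and> even (j - i) then f else 0) - (if i \<le> j - 2 \<and> even (j - 2 - i) then f else 0)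
        = (if i = j then f else 0)"
      by (cases "i = j"; cases "i = j - 1") auto
    then show ?thesis
      by (simp only: Ystar_op_conv Wstar_Y Y_op_diff) (simp add: algebra_simps)
  qed
  show "Y_op i (Y_op j f) = - Y_op (j + 1) (Y_op (i - 1) f)" for i j f
    using Y_op_Y_op[of i j f] by (simp add: eq_neg_iff_add_eq_0)
  show "hh (int n) \<in> Lam_Q.span (range (\<lambda>i. Y_op i 1))" for n
    using Y_op_1[of "- int n"] by (intro Lam_Q.span_base) (metis minus_minus rangeI)
  show "Lam_p n * Y_op i f = Y_op i (Lam_p n * f) + Y_op (i - int n) f + Y_op (i + int n) f"
    if "n \<ge> 1" for n i f
    unfolding Y_op_p[OF that] by simp
qed (auto simp: Ystar_op_conv Y_op_add Y_op_const Wstar_op_add Wstar_op_const Y_op_1 Wstar_op_1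
       Lam_Z_Wstar_op Lam_Z_diff right_diff_distrib)

interpretation W: fermion_pair W_op Wstar_op
proof
  show "Wstar_op j (W_op i f) = (if i = j then f else 0) - W_op (i - 1) (Wstar_op (j - 1) f)" for i j f
  proof -
    have "(if i \<le> j \<and> even (j - i) then f else 0) - (if i + 2 \<le> j \<and> even (j - (i + 2)) then f else 0)
        = (if i = j then f else 0)"
      by (cases "i = j"; cases "i = j - 1") auto
    then show ?thesis
      by (simp only: W_op_conv Wstar_Y Wstar_op_diff) (simp add: algebra_simps)
  qed
  show "W_op i (W_op j f) = - W_op (j + 1) (W_op (i - 1) f)" for i j f
  proof -
    have *: "Y_op i (Y_op j f) = - Y_op (j + 1) (Y_op (i - 1) f)" for i j
      using Y_op_Y_op[of i j f] by (simp add: eq_neg_iff_add_eq_0)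
    show ?thesis
      \<comment> \<open>Expanding both factors 1 - z^2 gives four products, each rewritten by the
        relation for \<open>Y_op\<close>.\<close>
      unfolding W_op_conv Y_op_diff using *[of i j] *[of "i + 2" j] *[of i "j + 2"] *[of "i + 2" "j + 2"]
      by (simp add: algebra_simps)
  qed
  show "hh (int n) \<in> Lam_Q.span (range (\<lambda>i. W_op i 1))" for n
  proof (induction n rule: less_induct)
    case (less n)
    \<comment> \<open>On 1 the mode gives h_n - h_(n-2), so h_n is recovered in steps of
      two.\<close>
    have eq: "hh (int n) = W_op (- int n) 1 + hh (int n - 2)"
      by (simp add: W_op_conv Y_op_1)
    have "hh (int n - 2) \<in> Lam_Q.span (range (\<lambda>i. W_op i 1))"
    proof (cases "n < 2")
      case False
      then have "int n - 2 = int (n - 2)" by simp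
      then show ?thesis using less[of "n - 2"] False by simp
    qed (simp add: Lam_Q.span_zero)
    then show ?case unfolding eq by (intro Lam_Q.span_add) (auto intro: Lam_Q.span_base)
  qed
  show "Lam_p n * W_op i f = W_op i (Lam_p n * f) + W_op (i - int n) f + W_op (i + int n) f"
    if "n \<ge> 1" for n i f
    unfolding W_op_conv Y_op_p[OF that] by (simp add: algebra_simps)
qed (auto simp: W_op_conv Y_op_add Y_op_const Wstar_op_add Wstar_op_const Y_op_1 Wstar_op_1
       Lam_Z_Wstar_op right_diff_distrib)

theorem theorem3p7:
  shows "(\<forall>xs. is_partition xs \<longrightarrow>
            op_word Y_op (map (\<lambda>a. - int a) xs)
              = (- 1) ^ sum_list xs * op_word Ystar_op (map int (conjugate xs)))
       \<and> (\<forall>xs. is_partition xs \<longrightarrow>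
            op_word W_op (map (\<lambda>a. - int a) xs)
              = (- 1) ^ sum_list xs * op_word Wstar_op (map int (conjugate xs)))
       \<and> is_Z_basis {xs. is_partition xs} (\<lambda>xs. op_word Y_op (map (\<lambda>a. - int a) xs)) Lam_Z
       \<and> is_Z_basis {xs. is_partition xs} (\<lambda>xs. op_word W_op (map (\<lambda>a. - int a) xs)) Lam_Z"
  using Y.T_conjugate W.T_conjugate Y.T_Z_basis W.T_Z_basis
  unfolding Y.T_def W.T_def by blast

end
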